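(* Let $\Omega\subset\mathbb{C}^n$ be a bounded domain, let $\mathcal{R}$ be an essentially reductive Hilbert module over $A(\Omega)$, and let $U$ be an isometric module map on $\mathcal{R}$ such that $\bigcap_{k=0}^\infty U^k\mathcal{R}=(0)$. Then $\mathcal{R}$ is subnormal, that is, there exists a reductive Hilbert module $\mathcal{N}$ over $A(\Omega)$ with $\mathcal{R}$ as a submodule.
   Context: $A(\Omega)$ is the completion, in the supremum norm over $\Omega$, of the functions holomorphic on a neighborhood of the closure of $\Omega$. All Hilbert spaces are complex and separable. A (contractive) Hilbert module over $A(\Omega)$ is a Hilbert space $\mathcal{M}$ which is a unital $A(\Omega)$-module with $\|\varphi f\|_{\mathcal{M}}\le\|\varphi\|_{A(\Omega)}\|f\|_{\mathcal{M}}$ for $\varphi\in A(\Omega)$, $f\in\mathcal{M}$. For $\varphi\in A(\Omega)$, $M_\varphi$ denotes the bounded operator of module multiplication by $\varphi$. The module is essentially reductive if every $M_\varphi$, $\varphi\in A(\Omega)$, is essentially normal, i.e. $M_\varphi^*M_\varphi-M_\varphi M_\varphi^*$ is compact. It is reductive if every $M_\varphi$, $\varphi\in A(\Omega)$, is normal. "$\mathcal{R}$ as a submodule" means $\mathcal{R}$ is (identified isometrically, as a module, with) a closed $A(\Omega)$-invariant subspace of $\mathcal{N}$. *)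

theory Defs
  imports "HOL-Analysis.Analysis" "HOL-Algebra.Module"
begin

text \<open>Holomorphy in several variables as complex differentiability: the real derivative exists
  and is complex linear.\<close>

definition holomorphic_sv :: "((complex ^ 'n::finite) \<Rightarrow> complex) \<Rightarrow> (complex ^ 'n) set \<Rightarrow> bool"
  where "holomorphic_sv f V \<longleftrightarrow>
    open V \<and> (\<forall>z\<in>V. \<exists>f'. (f has_derivative f') (at z) \<and> (\<forall>c v. f' (c *s v) = c * f' v))"

definition holomorphic_near_closure ::
    "(complex ^ 'n::finite) set \<Rightarrow> ((complex ^ 'n) \<Rightarrow> complex) \<Rightarrow> bool"
  where "holomorphic_near_closure \<Omega> f \<longleftrightarrow> (\<exists>V. closure \<Omega> \<subseteq> V \<and> holomorphic_sv f V)"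

text \<open>The completion is realised inside the bounded functions on \<open>\<Omega>\<close>, as the uniform closure.
  A function on \<open>\<Omega>\<close> is represented by its extension by \<open>0\<close>, so that distinct elements of the
  carrier differ on \<open>\<Omega>\<close>; in particular the unit is the indicator function of \<open>\<Omega>\<close>.\<close>

definition A_carrier :: "(complex ^ 'n::finite) set \<Rightarrow> ((complex ^ 'n) \<Rightarrow> complex) set"
  where "A_carrier \<Omega> = {\<phi>. (\<forall>z. z \<notin> \<Omega> \<longrightarrow> \<phi> z = 0) \<and>
    (\<exists>F :: nat \<Rightarrow> (complex ^ 'n) \<Rightarrow> complex.
      (\<forall>k. holomorphic_near_closure \<Omega> (F k)) \<and> uniform_limit \<Omega> F \<phi> sequentially)}"

definition A_alg :: "(complex ^ 'n::finite) set \<Rightarrow> ((complex ^ 'n) \<Rightarrow> complex) ring"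
  where "A_alg \<Omega> =
    \<lparr>carrier = A_carrier \<Omega>,
     mult = (\<lambda>\<phi> \<psi> z. \<phi> z * \<psi> z),
     one = (\<lambda>z. if z \<in> \<Omega> then 1 else 0),
     zero = (\<lambda>z. 0),
     add = (\<lambda>\<phi> \<psi> z. \<phi> z + \<psi> z)\<rparr>"

definition A_norm :: "(complex ^ 'n::finite) set \<Rightarrow> ((complex ^ 'n) \<Rightarrow> complex) \<Rightarrow> real"
  where "A_norm \<Omega> \<phi> = (SUP z\<in>\<Omega>. cmod (\<phi> z))"


lemma holomorphic_sv_const: "open V \<Longrightarrow> holomorphic_sv (\<lambda>z. c) V"
  unfolding holomorphic_sv_def by (auto intro!: exI[of _ "\<lambda>_. 0"])

lemma holomorphic_sv_add:
  assumes "holomorphic_sv f V" and "holomorphic_sv g V"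
  shows "holomorphic_sv (\<lambda>z. f z + g z) V"
  unfolding holomorphic_sv_def
proof (intro conjI ballI)
  show "open V" using assms unfolding holomorphic_sv_def by blast
  fix z assume "z \<in> V"
  then obtain f' g' where
    f': "(f has_derivative f') (at z)" "\<And>c v. f' (c *s v) = c * f' v" and
    g': "(g has_derivative g') (at z)" "\<And>c v. g' (c *s v) = c * g' v"
    using assms unfolding holomorphic_sv_def by meson
  show "\<exists>h'. ((\<lambda>z. f z + g z) has_derivative h') (at z) \<and> (\<forall>c v. h' (c *s v) = c * h' v)"
    by (intro exI conjI, rule has_derivative_add[OF f'(1) g'(1)])
       (simp add: f'(2) g'(2) algebra_simps)
qed

lemma holomorphic_sv_mult:
  assumes "holomorphic_sv f V" and "holomorphic_sv g V"
  shows "holomorphic_sv (\<lambda>z. f z * g z) V"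
  unfolding holomorphic_sv_def
proof (intro conjI ballI)
  show "open V" using assms unfolding holomorphic_sv_def by blast
  fix z assume "z \<in> V"
  then obtain f' g' where
    f': "(f has_derivative f') (at z)" "\<And>c v. f' (c *s v) = c * f' v" and
    g': "(g has_derivative g') (at z)" "\<And>c v. g' (c *s v) = c * g' v"
    using assms unfolding holomorphic_sv_def by meson
  show "\<exists>h'. ((\<lambda>z. f z * g z) has_derivative h') (at z) \<and> (\<forall>c v. h' (c *s v) = c * h' v)"
    by (intro exI conjI, rule has_derivative_mult[OF f'(1) g'(1)])
       (simp add: f'(2) g'(2) algebra_simps)
qed

lemma holomorphic_sv_subset:
  "holomorphic_sv f V \<Longrightarrow> open W \<Longrightarrow> W \<subseteq> V \<Longrightarrow> holomorphic_sv f W"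
  unfolding holomorphic_sv_def by blast

lemma holomorphic_near_closure_binop:
  assumes "holomorphic_near_closure \<Omega> f" and "holomorphic_near_closure \<Omega> g"
    and "\<And>V. holomorphic_sv f V \<Longrightarrow> holomorphic_sv g V \<Longrightarrow> holomorphic_sv h V"
  shows "holomorphic_near_closure \<Omega> h"
proof -
  obtain V W where V: "closure \<Omega> \<subseteq> V" "holomorphic_sv f V"
    and W: "closure \<Omega> \<subseteq> W" "holomorphic_sv g W"
    using assms unfolding holomorphic_near_closure_def by blast
  have "open (V \<inter> W)" using V W unfolding holomorphic_sv_def by blast
  then have "holomorphic_sv h (V \<inter> W)"
    using V W by (intro assms(3)) (auto intro: holomorphic_sv_subset)
  then show ?thesis
    unfolding holomorphic_near_closure_def using V W by blast
qed

lemma holomorphic_near_closure_bounded: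
  assumes "bounded \<Omega>" and "holomorphic_near_closure \<Omega> f"
  shows "bounded (f ` \<Omega>)"
proof -
  have "continuous_on (closure \<Omega>) f"
    using assms(2) unfolding holomorphic_near_closure_def holomorphic_sv_def
    by (meson continuous_at_imp_continuous_on has_derivative_continuous subsetD)
  then have "bounded (f ` closure \<Omega>)"
    using assms(1) by (simp add: compact_closure compact_continuous_image compact_imp_bounded)
  then show ?thesis
    by (meson bounded_subset closure_subset image_mono)
qed

lemma A_carrier_bounded:
  assumes "bounded \<Omega>" and "\<phi> \<in> A_carrier \<Omega>"
  shows "bounded (\<phi> ` \<Omega>)"
proof -
  obtain F where F: "\<And>k. holomorphic_near_closure \<Omega> (F k)" "uniform_limit \<Omega> F \<phi> sequentially"
    using assms(2) unfolding A_carrier_def by blast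
  from F(2) obtain k where k: "\<And>z. z \<in> \<Omega> \<Longrightarrow> dist (F k z) (\<phi> z) < 1"
    unfolding uniform_limit_iff eventually_sequentially by (meson le_refl zero_less_one)
  obtain B where B: "\<And>z. z \<in> \<Omega> \<Longrightarrow> cmod (F k z) \<le> B"
    using holomorphic_near_closure_bounded[OF assms(1) F(1)[of k]] by (auto simp: bounded_iff)
  have "cmod (\<phi> z) \<le> B + 1" if "z \<in> \<Omega>" for z
    using k[OF that] B[OF that] norm_triangle_ineq2[of "\<phi> z" "F k z"]
    by (simp add: dist_norm norm_minus_commute)
  then show ?thesis by (auto simp: bounded_iff)
qed

lemma A_carrier_const: "(\<lambda>z. if z \<in> \<Omega> then c else 0) \<in> A_carrier \<Omega>"
proof -
  have "holomorphic_near_closure \<Omega> (\<lambda>z. c)"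
    unfolding holomorphic_near_closure_def using holomorphic_sv_const[OF open_UNIV] by blast
  moreover have "uniform_limit \<Omega> (\<lambda>(k::nat) z. c) (\<lambda>z. if z \<in> \<Omega> then c else 0) sequentially"
    unfolding uniform_limit_iff by simp
  ultimately show ?thesis
    unfolding A_carrier_def by (auto intro!: exI[of _ "\<lambda>k z. c"])
qed

lemma A_carrier_add:
  assumes "\<phi> \<in> A_carrier \<Omega>" and "\<psi> \<in> A_carrier \<Omega>"
  shows "(\<lambda>z. \<phi> z + \<psi> z) \<in> A_carrier \<Omega>"
proof -
  obtain F G where F: "\<And>k. holomorphic_near_closure \<Omega> (F k)" "uniform_limit \<Omega> F \<phi> sequentially"
    and G: "\<And>k. holomorphic_near_closure \<Omega> (G k)" "uniform_limit \<Omega> G \<psi> sequentially"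
    using assms unfolding A_carrier_def by blast
  have "holomorphic_near_closure \<Omega> (\<lambda>z. F k z + G k z)" for k
    using F(1)[of k] G(1)[of k] holomorphic_sv_add by (rule holomorphic_near_closure_binop)
  then show ?thesis
    using assms uniform_limit_add[OF F(2) G(2)] unfolding A_carrier_def
    by (auto intro!: exI[of _ "\<lambda>k z. F k z + G k z"])
qed

lemma A_carrier_mult:
  assumes "bounded \<Omega>" and "\<phi> \<in> A_carrier \<Omega>" and "\<psi> \<in> A_carrier \<Omega>"
  shows "(\<lambda>z. \<phi> z * \<psi> z) \<in> A_carrier \<Omega>"
proof -
  obtain F G where F: "\<And>k. holomorphic_near_closure \<Omega> (F k)" "uniform_limit \<Omega> F \<phi> sequentially"
    and G: "\<And>k. holomorphic_near_closure \<Omega> (G k)" "uniform_limit \<Omega> G \<psi> sequentially"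
    using assms unfolding A_carrier_def by blast
  have "holomorphic_near_closure \<Omega> (\<lambda>z. F k z * G k z)" for k
    using F(1)[of k] G(1)[of k] holomorphic_sv_mult by (rule holomorphic_near_closure_binop)
  moreover have "uniform_limit \<Omega> (\<lambda>k z. F k z * G k z) (\<lambda>z. \<phi> z * \<psi> z) sequentially"
    using F(2) G(2) A_carrier_bounded[OF assms(1,2)] A_carrier_bounded[OF assms(1,3)]
    by (rule uniform_lim_mult)
  ultimately show ?thesis
    using assms unfolding A_carrier_def by (auto intro!: exI[of _ "\<lambda>k z. F k z * G k z"])
qed

lemma cring_A_alg:
  assumes "bounded \<Omega>"
  shows "cring (A_alg \<Omega>)"
proof (rule cringI)
  have neg: "(\<lambda>z. - \<phi> z) \<in> A_carrier \<Omega>" if "\<phi> \<in> A_carrier \<Omega>" for \<phi>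
  proof -
    have "(\<lambda>z. - \<phi> z) = (\<lambda>z. (if z \<in> \<Omega> then - 1 else 0) * \<phi> z)"
      using that unfolding A_carrier_def by (auto simp: fun_eq_iff)
    then show ?thesis using A_carrier_mult[OF assms A_carrier_const that] by simp
  qed
  show "abelian_group (A_alg \<Omega>)"
  proof (rule abelian_groupI)
    fix \<phi> assume "\<phi> \<in> carrier (A_alg \<Omega>)"
    then show "\<exists>\<psi>\<in>carrier (A_alg \<Omega>). \<psi> \<oplus>\<^bsub>A_alg \<Omega>\<^esub> \<phi> = \<zero>\<^bsub>A_alg \<Omega>\<^esub>"
      by (intro bexI[of _ "\<lambda>z. - \<phi> z"]) (auto simp: A_alg_def neg)
  qed (use A_carrier_const[where c = 0] in \<open>auto simp: A_alg_def A_carrier_add algebra_simps\<close>)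
  have unit: "(\<lambda>z. (if z \<in> \<Omega> then 1 else 0) * \<phi> z) = \<phi>" if "\<phi> \<in> A_carrier \<Omega>" for \<phi>
    using that unfolding A_carrier_def by (auto simp: fun_eq_iff)
  show "comm_monoid (A_alg \<Omega>)"
  proof (rule comm_monoidI)
    show "\<one>\<^bsub>A_alg \<Omega>\<^esub> \<otimes>\<^bsub>A_alg \<Omega>\<^esub> \<phi> = \<phi>" if "\<phi> \<in> carrier (A_alg \<Omega>)" for \<phi>
      using that unit[of \<phi>] unfolding A_alg_def ring.simps monoid.simps partial_object.simps by blast
  qed (auto simp: A_alg_def A_carrier_mult[OF assms] A_carrier_const mult_ac)
qed (auto simp: A_alg_def algebra_simps)

lemma A_norm_bdd_above:
  "bounded \<Omega> \<Longrightarrow> \<phi> \<in> A_carrier \<Omega> \<Longrightarrow> bdd_above ((\<lambda>z. cmod (\<phi> z)) ` \<Omega>)"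
  using A_carrier_bounded[of \<Omega> \<phi>] by (auto simp: bounded_iff bdd_above_def)


text \<open>The fields \<open>mult\<close> and \<open>one\<close> that the record \<open>module\<close>
  inherits from \<open>ring\<close> carry no meaning here, as usual for \<open>HOL-Algebra\<close> modules.\<close>

definition complex_ring :: "complex ring"
  where "complex_ring = \<lparr>carrier = UNIV, mult = (*), one = 1, zero = 0, add = (+)\<rparr>"

lemma cring_complex_ring: "cring complex_ring"
proof (rule cringI)
  show "abelian_group complex_ring"
    by (rule abelian_groupI) (auto simp: complex_ring_def algebra_simps intro: exI[of _ "- x" for x])
  show "comm_monoid complex_ring"
    by (rule comm_monoidI) (auto simp: complex_ring_def)
qed (auto simp: complex_ring_def algebra_simps)

record 'a inner_space = "(complex, 'a) module" +
  ip :: "'a \<Rightarrow> 'a \<Rightarrow> complex"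

definition hnorm :: "('a, 'm) inner_space_scheme \<Rightarrow> 'a \<Rightarrow> real"
  where "hnorm H x = sqrt (Re (ip H x x))"

text \<open>The locale \<open>Metric_space\<close> requires non-negativity and symmetry on the whole type,
  hence the value \<open>0\<close> off the carrier; it does not influence the topology on the carrier.\<close>

definition hdist :: "('a, 'm) inner_space_scheme \<Rightarrow> 'a \<Rightarrow> 'a \<Rightarrow> real"
  where "hdist H x y =
    (if x \<in> carrier H \<and> y \<in> carrier H then hnorm H (x \<ominus>\<^bsub>H\<^esub> y) else 0)"

definition htopology :: "('a, 'm) inner_space_scheme \<Rightarrow> 'a topology"
  where "htopology H = Metric_space.mtopology (carrier H) (hdist H)"

definition inner_product_space :: "('a, 'm) inner_space_scheme \<Rightarrow> bool"
  where "inner_product_space H \<longleftrightarrow>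
    Module.module complex_ring H \<and>
    (\<forall>x\<in>carrier H. \<forall>y\<in>carrier H. \<forall>z\<in>carrier H. ip H (x \<oplus>\<^bsub>H\<^esub> y) z = ip H x z + ip H y z) \<and>
    (\<forall>c. \<forall>x\<in>carrier H. \<forall>y\<in>carrier H. ip H (c \<odot>\<^bsub>H\<^esub> x) y = c * ip H x y) \<and>
    (\<forall>x\<in>carrier H. \<forall>y\<in>carrier H. ip H y x = cnj (ip H x y)) \<and>
    (\<forall>x\<in>carrier H. 0 \<le> Re (ip H x x)) \<and>
    (\<forall>x\<in>carrier H. ip H x x = 0 \<longrightarrow> x = \<zero>\<^bsub>H\<^esub>)"

definition hilbert_space :: "('a, 'm) inner_space_scheme \<Rightarrow> bool"
  where "hilbert_space H \<longleftrightarrow>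
    inner_product_space H \<and>
    Metric_space.mcomplete (carrier H) (hdist H) \<and>
    separable_space (htopology H)"

text \<open>Operators are functions of which only the values on the carrier matter. For a bounded linear
  operator \<open>T\<close> the element described below exists uniquely by the Riesz representation theorem.\<close>

definition adj :: "('a, 'm) inner_space_scheme \<Rightarrow> ('a \<Rightarrow> 'a) \<Rightarrow> 'a \<Rightarrow> 'a"
  where "adj H T y = (THE w. w \<in> carrier H \<and> (\<forall>x\<in>carrier H. ip H (T x) y = ip H x w))"

definition normal_op :: "('a, 'm) inner_space_scheme \<Rightarrow> ('a \<Rightarrow> 'a) \<Rightarrow> bool"
  where "normal_op H T \<longleftrightarrow> (\<forall>x\<in>carrier H. adj H T (T x) = T (adj H T x))"

definition compact_op :: "('a, 'm) inner_space_scheme \<Rightarrow> ('a \<Rightarrow> 'a) \<Rightarrow> bool"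
  where "compact_op H T \<longleftrightarrow>
    T \<in> carrier H \<rightarrow> carrier H \<and>
    compactin (htopology H) (htopology H closure_of (T ` {x \<in> carrier H. hnorm H x \<le> 1}))"

definition essentially_normal_op :: "('a, 'm) inner_space_scheme \<Rightarrow> ('a \<Rightarrow> 'a) \<Rightarrow> bool"
  where "essentially_normal_op H T \<longleftrightarrow>
    compact_op H (\<lambda>x. adj H T (T x) \<ominus>\<^bsub>H\<^esub> T (adj H T x))"


text \<open>The field \<open>smult\<close> is multiplication by complex scalars, the
  field \<open>act\<close> is multiplication by elements of \<open>A(\<Omega>)\<close>, so \<open>act M \<phi>\<close> is the operator \<open>M\<^sub>\<phi>\<close>.\<close>

record ('a, 'n::finite) hilbert_module = "'a inner_space" +
  act :: "((complex ^ 'n) \<Rightarrow> complex) \<Rightarrow> 'a \<Rightarrow> 'a"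

definition A_module ::
    "('a, 'n::finite) hilbert_module \<Rightarrow> ((complex ^ 'n) \<Rightarrow> complex, 'a) module"
  where "A_module M =
    \<lparr>carrier = carrier M, mult = mult M, one = one M, zero = zero M, add = add M, smult = act M\<rparr>"

definition hilbert_module_over ::
    "(complex ^ 'n::finite) set \<Rightarrow> ('a, 'n) hilbert_module \<Rightarrow> bool"
  where "hilbert_module_over \<Omega> M \<longleftrightarrow>
    hilbert_space M \<and>
    Module.module (A_alg \<Omega>) (A_module M) \<and>
    (\<forall>c. \<forall>\<phi>\<in>A_carrier \<Omega>. \<forall>x\<in>carrier M. act M (\<lambda>z. c * \<phi> z) x = c \<odot>\<^bsub>M\<^esub> act M \<phi> x) \<and>
    (\<forall>\<phi>\<in>A_carrier \<Omega>. \<forall>x\<in>carrier M. hnorm M (act M \<phi> x) \<le> A_norm \<Omega> \<phi> * hnorm M x)"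

definition reductive :: "(complex ^ 'n::finite) set \<Rightarrow> ('a, 'n) hilbert_module \<Rightarrow> bool"
  where "reductive \<Omega> M \<longleftrightarrow>
    hilbert_module_over \<Omega> M \<and> (\<forall>\<phi>\<in>A_carrier \<Omega>. normal_op M (act M \<phi>))"

definition essentially_reductive ::
    "(complex ^ 'n::finite) set \<Rightarrow> ('a, 'n) hilbert_module \<Rightarrow> bool"
  where "essentially_reductive \<Omega> M \<longleftrightarrow>
    hilbert_module_over \<Omega> M \<and> (\<forall>\<phi>\<in>A_carrier \<Omega>. essentially_normal_op M (act M \<phi>))"

text \<open>Complex linearity is the case of constant \<open>\<phi>\<close>.\<close>

definition isometric_module_map ::
    "(complex ^ 'n::finite) set \<Rightarrow> ('a, 'n) hilbert_module \<Rightarrow> ('b, 'n) hilbert_module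
      \<Rightarrow> ('a \<Rightarrow> 'b) \<Rightarrow> bool"
  where "isometric_module_map \<Omega> M N J \<longleftrightarrow>
    J \<in> carrier M \<rightarrow> carrier N \<and>
    (\<forall>x\<in>carrier M. \<forall>y\<in>carrier M. J (x \<oplus>\<^bsub>M\<^esub> y) = J x \<oplus>\<^bsub>N\<^esub> J y) \<and>
    (\<forall>\<phi>\<in>A_carrier \<Omega>. \<forall>x\<in>carrier M. J (act M \<phi> x) = act N \<phi> (J x)) \<and>
    (\<forall>x\<in>carrier M. hnorm N (J x) = hnorm M x)"

definition embeds_as_submodule ::
    "(complex ^ 'n::finite) set \<Rightarrow> ('a, 'n) hilbert_module \<Rightarrow> ('b, 'n) hilbert_module \<Rightarrow> bool"
  where "embeds_as_submodule \<Omega> M N \<longleftrightarrow>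
    (\<exists>J. isometric_module_map \<Omega> M N J \<and>
      submodule (J ` carrier M) (A_alg \<Omega>) (A_module N) \<and>
      closedin (htopology N) (J ` carrier M))"

text \<open>The existential quantifier needs a fixed element type. A separable Hilbert space has at most
  the cardinality of the continuum, so every separable Hilbert module has an isomorphic copy
  whose carrier is a set of complex sequences, and choosing this type loses no generality.\<close>

definition subnormal :: "(complex ^ 'n::finite) set \<Rightarrow> ('a, 'n) hilbert_module \<Rightarrow> bool"
  where "subnormal \<Omega> M \<longleftrightarrow>
    (\<exists>N :: (nat \<Rightarrow> complex, 'n) hilbert_module. reductive \<Omega> N \<and> embeds_as_submodule \<Omega> M N)"

end

theory Submission
  imports Defs
begin

text \<open>Let \<open>W\<close> on \<open>N\<close> be the minimal unitary extension of \<open>U\<close>, so that the subspaces \<open>W^-k R\<close> increase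
  to a dense subspace of \<open>N\<close>. Since \<open>U\<close> is a module map, each \<open>M_\<phi>\<close> extends to an operator \<open>N_\<phi>\<close>
  commuting with \<open>W\<close> and of the same norm. For \<open>x\<close> in \<open>R\<close> one has \<open>\<parallel>N_\<phi> W^-j x\<parallel> = \<parallel>M_\<phi> x\<parallel>\<close>, whereas
  \<open>\<parallel>N_\<phi>* W^-j x\<parallel>\<close> is the limit of \<open>\<parallel>M_\<phi>* U^k x\<parallel>\<close>. With \<open>K = M_\<phi>* M_\<phi> - M_\<phi> M_\<phi>*\<close>, the square of the
  latter norm is \<open>\<parallel>M_\<phi> x\<parallel>^2 - \<langle>K U^k x, U^k x\<rangle>\<close>. As \<open>U\<close> is pure, \<open>U^k x\<close> tends weakly to \<open>0\<close>, and
  compactness of \<open>K\<close> makes the error term vanish. So \<open>N_\<phi>\<close> and \<open>N_\<phi>*\<close> have equal norms on a dense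
  subspace, which is normality.\<close>

section \<open>Inner product spaces and Hilbert spaces\<close>

text \<open>Essential normality controls a commutator only up to a compact operator, and the
  extension must remove that error completely. Vectors moved far out by a pure isometry lose contact
  with every compact operator; purity enters as strong convergence to 0 of the projections onto the
  ranges of the powers of \<open>U\<close>, which gives weak convergence of \<open>U^k x\<close>.
  Equality of norms is then enough because on a complex space a quadratic form determines its
  sesquilinear form. One extension serves all \<phi> at once, so the normal operators obtained form
  a module action over the whole algebra and not a family of unrelated extensions. Two constraints
  shape the construction. The carrier must consist of complex sequences, so the extension is given
  by explicit coordinates instead of a quotient or a union of copies of \<open>R\<close>. And the
  compression of an extended operator's adjoint to \<open>R\<close> is the adjoint of the original
  operator, while the extended operator has no such simple form in coordinates; the module laws are
  therefore first proved for adjoints and then dualised.\<close>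

lemma nonneg_quadratic:
  fixes a b u :: real
  assumes "0 < a" and nonneg: "\<And>t. 0 \<le> u + 2 * t * b + t\<^sup>2 * a"
  shows "b\<^sup>2 \<le> a * u"
proof -
  \<comment> \<open>The choice \<open>- b / a\<close> is the minimiser of the quadratic in
    \<open>t\<close>.\<close>
  have "u + 2 * (- b / a) * b + (- b / a)\<^sup>2 * a = u - b\<^sup>2 / a"
    using assms(1) by (simp add: field_simps power2_eq_square)
  then have "b\<^sup>2 / a \<le> u" using nonneg[of "- b / a"] by simp
  then show ?thesis using assms(1) by (simp add: field_simps)
qed

locale inner_product =
  fixes H :: "('a, 'm) inner_space_scheme" (structure)
  assumes inner_product_space: "inner_product_space H"
begin

sublocale vs: Module.module complex_ring H
  using inner_product_space by (simp add: inner_product_space_def)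

lemma smult_carrier [simp, intro]: "x \<in> carrier H \<Longrightarrow> c \<odot> x \<in> carrier H"
  using vs.smult_closed[of c x] by (simp add: complex_ring_def)

lemma ip_add_left [simp]:
  "\<lbrakk>x \<in> carrier H; y \<in> carrier H; z \<in> carrier H\<rbrakk> \<Longrightarrow> ip H (x \<oplus> y) z = ip H x z + ip H y z"
  using inner_product_space unfolding inner_product_space_def by blast

lemma ip_smult_left [simp]:
  "\<lbrakk>x \<in> carrier H; y \<in> carrier H\<rbrakk> \<Longrightarrow> ip H (c \<odot> x) y = c * ip H x y"
  using inner_product_space unfolding inner_product_space_def by blast

lemma ip_commute: "\<lbrakk>x \<in> carrier H; y \<in> carrier H\<rbrakk> \<Longrightarrow> ip H y x = cnj (ip H x y)"
  using inner_product_space unfolding inner_product_space_def by blast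

lemma Re_ip_self_ge_0 [simp]: "x \<in> carrier H \<Longrightarrow> 0 \<le> Re (ip H x x)"
  using inner_product_space unfolding inner_product_space_def by blast

lemma ip_self_eq_0D: "\<lbrakk>x \<in> carrier H; ip H x x = 0\<rbrakk> \<Longrightarrow> x = \<zero>"
  using inner_product_space unfolding inner_product_space_def by blast

lemma ip_add_right [simp]:
  "\<lbrakk>x \<in> carrier H; y \<in> carrier H; z \<in> carrier H\<rbrakk> \<Longrightarrow> ip H z (x \<oplus> y) = ip H z x + ip H z y"
  using ip_commute[of "x \<oplus> y" z] ip_commute[of x z] ip_commute[of y z] by simp

lemma ip_smult_right [simp]:
  "\<lbrakk>x \<in> carrier H; y \<in> carrier H\<rbrakk> \<Longrightarrow> ip H y (c \<odot> x) = cnj c * ip H y x"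
  using ip_commute[of "c \<odot> x" y] ip_commute[of x y] by simp

lemma ip_zero_left [simp]: "z \<in> carrier H \<Longrightarrow> ip H \<zero> z = 0"
  using ip_add_left[of \<zero> \<zero> z] by (simp del: ip_add_left)

lemma ip_zero_right [simp]: "z \<in> carrier H \<Longrightarrow> ip H z \<zero> = 0"
  using ip_add_right[of \<zero> \<zero> z] by (simp del: ip_add_right)

lemma ip_minus_left [simp]:
  "\<lbrakk>x \<in> carrier H; y \<in> carrier H; z \<in> carrier H\<rbrakk> \<Longrightarrow> ip H (x \<ominus> y) z = ip H x z - ip H y z"
  using ip_add_left[of "\<ominus> y" y z] ip_add_left[of x "\<ominus> y" z]
  by (simp add: a_minus_def vs.M.l_neg eq_neg_iff_add_eq_0 del: ip_add_left)

lemma ip_minus_right [simp]: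
  "\<lbrakk>x \<in> carrier H; y \<in> carrier H; z \<in> carrier H\<rbrakk> \<Longrightarrow> ip H z (x \<ominus> y) = ip H z x - ip H z y"
  using ip_commute[of "x \<ominus> y" z] ip_commute[of x z] ip_commute[of y z]
  by (simp add: vs.M.minus_closed)

lemma minus_carrier [simp, intro]: "\<lbrakk>x \<in> carrier H; y \<in> carrier H\<rbrakk> \<Longrightarrow> x \<ominus> y \<in> carrier H"
  by (rule vs.M.minus_closed)

lemma zero_carrier: "\<zero> \<in> carrier H"
  by simp

lemma minus_eq_zero_iff [simp]: "\<lbrakk>x \<in> carrier H; y \<in> carrier H\<rbrakk> \<Longrightarrow> x \<ominus> y = \<zero> \<longleftrightarrow> x = y"
  using vs.M.minus_equality[of x "\<ominus> y"] by (auto simp: a_minus_def vs.M.r_neg)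

text \<open>Testing against all vectors replaces calculation with module terms by calculation with
  complex numbers; most vector identities below are proved in this way.\<close>

lemma vec_eqI:
  assumes "x \<in> carrier H" "y \<in> carrier H" and "\<And>z. z \<in> carrier H \<Longrightarrow> ip H x z = ip H y z"
  shows "x = y"
proof -
  have "ip H (x \<ominus> y) (x \<ominus> y) = 0"
    using assms(1,2) assms(3)[of "x \<ominus> y"] by (simp del: ip_minus_right)
  then have "x \<ominus> y = \<zero>" using assms by (intro ip_self_eq_0D) auto
  then show ?thesis using assms(1,2) by simp
qed

lemma vec_eqI_right:
  assumes "x \<in> carrier H" "y \<in> carrier H" and "\<And>z. z \<in> carrier H \<Longrightarrow> ip H z x = ip H z y"
  shows "x = y"
  using assms by (intro vec_eqI) (metis ip_commute)+

lemma minus_eq_add_smult: "\<lbrakk>x \<in> carrier H; y \<in> carrier H\<rbrakk> \<Longrightarrow> x \<ominus> y = x \<oplus> (-1) \<odot> y"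
  by (rule vec_eqI) auto

lemma Im_ip_self [simp]: "x \<in> carrier H \<Longrightarrow> Im (ip H x x) = 0"
  using ip_commute[of x x] by (metis complex_cnj_cancel_iff cnj.simps(2) equal_neg_zero)

lemma hnorm_ge_0 [simp]: "x \<in> carrier H \<Longrightarrow> 0 \<le> hnorm H x"
  by (simp add: hnorm_def)

lemma hnorm_sq: "x \<in> carrier H \<Longrightarrow> (hnorm H x)\<^sup>2 = Re (ip H x x)"
  by (simp add: hnorm_def)

lemma ip_self: "x \<in> carrier H \<Longrightarrow> ip H x x = complex_of_real ((hnorm H x)\<^sup>2)"
  by (simp add: hnorm_sq complex_eq_iff)

lemma hnorm_eq_0 [simp]: "x \<in> carrier H \<Longrightarrow> hnorm H x = 0 \<longleftrightarrow> x = \<zero>"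
  using ip_self[of x] ip_self_eq_0D[of x] by auto

lemma hnorm_zero [simp]: "hnorm H \<zero> = 0"
  by simp

lemma hnorm_smult [simp]: "x \<in> carrier H \<Longrightarrow> hnorm H (c \<odot> x) = cmod c * hnorm H x"
proof -
  assume x: "x \<in> carrier H"
  have "ip H (c \<odot> x) (c \<odot> x) = (c * cnj c) * ip H x x"
    using x by simp
  also have "\<dots> = complex_of_real ((cmod c * hnorm H x)\<^sup>2)"
    unfolding complex_norm_square[symmetric] ip_self[OF x] by (simp add: power_mult_distrib)
  finally have "ip H (c \<odot> x) (c \<odot> x) = complex_of_real ((cmod c * hnorm H x)\<^sup>2)" .
  then have "(hnorm H (c \<odot> x))\<^sup>2 = (cmod c * hnorm H x)\<^sup>2"
    using x by (simp add: hnorm_sq)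
  then show ?thesis using x by simp
qed

lemma hnorm_minus_sq:
  assumes "x \<in> carrier H" "y \<in> carrier H"
  shows "(hnorm H (x \<ominus> y))\<^sup>2 = (hnorm H x)\<^sup>2 + (hnorm H y)\<^sup>2 - 2 * Re (ip H x y)"
  using assms ip_commute[of x y] by (simp add: hnorm_sq)

lemma hnorm_add_sq:
  assumes "x \<in> carrier H" "y \<in> carrier H"
  shows "(hnorm H (x \<oplus> y))\<^sup>2 = (hnorm H x)\<^sup>2 + (hnorm H y)\<^sup>2 + 2 * Re (ip H x y)"
  using assms ip_commute[of x y] by (simp add: hnorm_sq)

lemma Cauchy_Schwarz:
  assumes x: "x \<in> carrier H" and y: "y \<in> carrier H"
  shows "cmod (ip H x y) \<le> hnorm H x * hnorm H y"
proof (cases "y = \<zero>")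
  case True
  then show ?thesis using x by simp
next
  case False
  then have ny: "0 < hnorm H y" using y by (metis hnorm_eq_0 hnorm_ge_0 order_le_less)
  \<comment> \<open>\<open>c \<odot> y\<close> is the orthogonal projection of \<open>x\<close> onto
    the line through \<open>y\<close>.\<close>
  define c where "c = ip H x y / complex_of_real ((hnorm H y)\<^sup>2)"
  have "0 \<le> (hnorm H (x \<ominus> c \<odot> y))\<^sup>2" by simp
  also have "\<dots> = (hnorm H x)\<^sup>2 + (cmod c * hnorm H y)\<^sup>2 - 2 * Re (cnj c * ip H x y)"
    using x y by (simp add: hnorm_minus_sq)
  also have "cnj c * ip H x y = complex_of_real ((cmod (ip H x y))\<^sup>2 / (hnorm H y)\<^sup>2)"
    unfolding c_def of_real_divide complex_norm_square[of "ip H x y"] by simp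
  also have "(cmod c * hnorm H y)\<^sup>2 = (cmod (ip H x y))\<^sup>2 / (hnorm H y)\<^sup>2"
    using ny unfolding c_def by (simp add: norm_divide power2_eq_square norm_mult field_simps)
  finally have "(cmod (ip H x y))\<^sup>2 / (hnorm H y)\<^sup>2 \<le> (hnorm H x)\<^sup>2"
    by simp
  then have "(cmod (ip H x y))\<^sup>2 \<le> (hnorm H x * hnorm H y)\<^sup>2"
    using ny by (simp add: power_mult_distrib divide_le_eq)
  then show ?thesis by (rule power2_le_imp_le) (use x y in auto)
qed

lemma hnorm_triangle:
  assumes x: "x \<in> carrier H" and y: "y \<in> carrier H"
  shows "hnorm H (x \<oplus> y) \<le> hnorm H x + hnorm H y"
proof -
  have "Re (ip H x y) \<le> hnorm H x * hnorm H y"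
    using Cauchy_Schwarz[OF assms] complex_Re_le_cmod order_trans by blast
  then have "(hnorm H (x \<oplus> y))\<^sup>2 \<le> (hnorm H x + hnorm H y)\<^sup>2"
    using assms by (simp add: hnorm_add_sq power2_sum)
  then show ?thesis by (rule power2_le_imp_le) (use x y in auto)
qed

lemma hnorm_minus_commute:
  "\<lbrakk>x \<in> carrier H; y \<in> carrier H\<rbrakk> \<Longrightarrow> hnorm H (x \<ominus> y) = hnorm H (y \<ominus> x)"
  by (simp add: hnorm_def)

lemma hnorm_triangle_minus:
  assumes "x \<in> carrier H" "y \<in> carrier H" "z \<in> carrier H"
  shows "hnorm H (x \<ominus> z) \<le> hnorm H (x \<ominus> y) + hnorm H (y \<ominus> z)"
proof -
  have "x \<ominus> z = (x \<ominus> y) \<oplus> (y \<ominus> z)" by (rule vec_eqI) (use assms in auto)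
  then show ?thesis using hnorm_triangle[of "x \<ominus> y" "y \<ominus> z"] assms by simp
qed

lemma hnorm_diff_le:
  assumes "x \<in> carrier H" "y \<in> carrier H"
  shows "\<bar>hnorm H x - hnorm H y\<bar> \<le> hnorm H (x \<ominus> y)"
proof -
  have "x = (x \<ominus> y) \<oplus> y" "y = (y \<ominus> x) \<oplus> x" by (rule vec_eqI; use assms in auto)+
  then have "hnorm H x \<le> hnorm H (x \<ominus> y) + hnorm H y" "hnorm H y \<le> hnorm H (y \<ominus> x) + hnorm H x"
    using hnorm_triangle[of "x \<ominus> y" y] hnorm_triangle[of "y \<ominus> x" x] assms by auto
  then show ?thesis using hnorm_minus_commute[OF assms] by simp
qed

sublocale metric: Metric_space "carrier H" "hdist H"
proof
  show "hdist H x z \<le> hdist H x y + hdist H y z"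
    if "x \<in> carrier H" "y \<in> carrier H" "z \<in> carrier H" for x y z
    using hnorm_triangle_minus[OF that] that by (simp add: hdist_def)
qed (auto simp: hdist_def hnorm_minus_commute)

text \<open>Norm convergence is encoded as a real null sequence, so that limit theorems for real
  sequences apply; \<open>limitin_iff_tends\<close> leads back to the topology.\<close>

definition tends :: "(nat \<Rightarrow> 'a) \<Rightarrow> 'a \<Rightarrow> bool"
  where "tends s l \<longleftrightarrow> (\<lambda>k. hnorm H (s k \<ominus> l)) \<longlonglongrightarrow> 0"

lemma limitin_iff_tends:
  assumes "\<And>k. s k \<in> carrier H" "l \<in> carrier H"
  shows "limitin (htopology H) s l sequentially \<longleftrightarrow> tends s l"
  using assms unfolding htopology_def metric.limitin_metric_dist_null tends_def
  by (simp add: hdist_def)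

lemma tends_ip_left:
  assumes "\<And>k. s k \<in> carrier H" "l \<in> carrier H" "tends s l" "y \<in> carrier H"
  shows "(\<lambda>k. ip H (s k) y) \<longlonglongrightarrow> ip H l y"
proof (rule LIM_zero_cancel, rule Lim_null_comparison)
  show "\<forall>\<^sub>F k in sequentially. norm (ip H (s k) y - ip H l y) \<le> hnorm H (s k \<ominus> l) * hnorm H y"
    using assms Cauchy_Schwarz[of "s _ \<ominus> l" y] by (intro always_eventually) simp
  show "(\<lambda>k. hnorm H (s k \<ominus> l) * hnorm H y) \<longlonglongrightarrow> 0"
    using assms(3) unfolding tends_def by (rule tendsto_mult_left_zero)
qed

lemma tends_hnorm:
  assumes "\<And>k. s k \<in> carrier H" "l \<in> carrier H" "tends s l"
  shows "(\<lambda>k. hnorm H (s k)) \<longlonglongrightarrow> hnorm H l"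
proof (rule LIM_zero_cancel, rule Lim_null_comparison)
  show "\<forall>\<^sub>F k in sequentially. norm (hnorm H (s k) - hnorm H l) \<le> hnorm H (s k \<ominus> l)"
    using assms hnorm_diff_le by (intro always_eventually) simp
qed (use assms(3) in \<open>simp add: tends_def\<close>)

text \<open>The values at \<open>x \<oplus> y\<close> and \<open>x \<oplus> \<i> \<odot> y\<close>
  make both the sum and the difference of \<open>Q x y\<close> and \<open>Q y x\<close> vanish. With
  \<open>Q\<close> a difference of two forms, equality of norms becomes equality of inner
  products.\<close>

lemma polarization:
  assumes Q: "\<And>x. x \<in> carrier H \<Longrightarrow> Q x x = 0"
    and addl: "\<And>x y z. \<lbrakk>x \<in> carrier H; y \<in> carrier H; z \<in> carrier H\<rbrakk> \<Longrightarrow> Q (x \<oplus> y) z = Q x z + Q y z"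
    and addr: "\<And>x y z. \<lbrakk>x \<in> carrier H; y \<in> carrier H; z \<in> carrier H\<rbrakk> \<Longrightarrow> Q z (x \<oplus> y) = Q z x + Q z y"
    and smultl: "\<And>c x y. \<lbrakk>x \<in> carrier H; y \<in> carrier H\<rbrakk> \<Longrightarrow> Q (c \<odot> x) y = c * Q x y"
    and smultr: "\<And>c x y. \<lbrakk>x \<in> carrier H; y \<in> carrier H\<rbrakk> \<Longrightarrow> Q y (c \<odot> x) = cnj c * Q y x"
    and xy: "x \<in> carrier H" "y \<in> carrier H"
  shows "Q x y = (0::complex)"
proof -
  have "Q (x \<oplus> y) (x \<oplus> y) = 0" "Q (x \<oplus> \<i> \<odot> y) (x \<oplus> \<i> \<odot> y) = 0"
    using xy by (intro Q; simp)+
  then have "Q x y + Q y x = 0" "\<i> * Q y x - \<i> * Q x y = 0"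
    using xy by (simp_all add: addl addr smultl smultr Q[OF xy(1)] Q[OF xy(2)])
  then show ?thesis by (simp add: add_eq_0_iff)
qed

lemma tends_unique:
  assumes "\<And>k. s k \<in> carrier H" "l \<in> carrier H" "l' \<in> carrier H" "tends s l" "tends s l'"
  shows "l = l'"
  using assms by (intro vec_eqI LIMSEQ_unique[OF tends_ip_left tends_ip_left])

text \<open>Expresses a mixed inner product by diagonal ones, whose convergence follows from that of
  norms; see \<open>lim_ip_tendsto\<close>.\<close>

lemma ip_polar:
  assumes "x \<in> carrier H" "y \<in> carrier H"
  shows "ip H x y = (ip H (x \<oplus> y) (x \<oplus> y) - ip H (x \<ominus> y) (x \<ominus> y)
    + \<i> * ip H (x \<oplus> \<i> \<odot> y) (x \<oplus> \<i> \<odot> y) - \<i> * ip H (x \<ominus> \<i> \<odot> y) (x \<ominus> \<i> \<odot> y)) / 4"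
  using assms by (simp add: algebra_simps)

lemma hilbert_spaceI:
  assumes complete: "\<And>s. \<lbrakk>\<And>k. s k \<in> carrier H;
      \<And>e. 0 < e \<Longrightarrow> \<exists>K. \<forall>m\<ge>K. \<forall>n\<ge>K. hnorm H (s m \<ominus> s n) < e\<rbrakk> \<Longrightarrow> \<exists>l\<in>carrier H. tends s l"
    and C: "countable C" "C \<subseteq> carrier H"
    and dense: "\<And>x e. \<lbrakk>x \<in> carrier H; 0 < e\<rbrakk> \<Longrightarrow> \<exists>y\<in>C. hnorm H (x \<ominus> y) < e"
  shows "hilbert_space H"
  unfolding hilbert_space_def
proof (intro conjI)
  show "metric.mcomplete"
    unfolding metric.mcomplete_def metric.MCauchy_def
  proof (intro allI impI)
    fix s :: "nat \<Rightarrow> 'a" assume s: "range s \<subseteq> carrier H \<and>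
      (\<forall>e>0. \<exists>N. \<forall>n n'. N \<le> n \<longrightarrow> N \<le> n' \<longrightarrow> hdist H (s n) (s n') < e)"
    then have sc: "s k \<in> carrier H" for k by blast
    have "\<exists>l\<in>carrier H. tends s l"
      using s sc by (intro complete) (auto simp: hdist_def)
    then show "\<exists>x. limitin metric.mtopology s x sequentially"
      using limitin_iff_tends sc unfolding htopology_def by blast
  qed
  have "metric.mtopology closure_of C = carrier H"
    unfolding metric.metric_closure_of using C(2) dense by (fastforce simp: hdist_def)
  then show "separable_space (htopology H)"
    unfolding separable_space_def htopology_def using C by auto
qed (rule inner_product_space)

end

section \<open>Completeness, Riesz representation, adjoints and compact operators\<close>

locale hilbert = inner_product H for H :: "('a, 'm) inner_space_scheme" (structure) +
  assumes hilbert_space: "hilbert_space H"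
begin

text \<open>The Cauchy condition is required for ordered indices only, because the estimates that
  feed it, such as \<open>proj_dist_sq\<close>, are proved for ordered indices.\<close>

lemma complete:
  assumes s: "\<And>k. s k \<in> carrier H"
    and C: "\<And>e. 0 < e \<Longrightarrow> \<exists>K. \<forall>m\<ge>K. \<forall>n\<ge>m. hnorm H (s m \<ominus> s n) < e"
  obtains l where "l \<in> carrier H" "tends s l"
proof -
  have "metric.MCauchy s"
    unfolding metric.MCauchy_def
  proof (intro conjI allI impI)
    fix e :: real assume "0 < e"
    then obtain K where K: "\<And>m n. K \<le> m \<Longrightarrow> m \<le> n \<Longrightarrow> hnorm H (s m \<ominus> s n) < e"
      using C by blast
    have "hdist H (s n) (s n') < e" if "K \<le> n" "K \<le> n'" for n n'
      using K[of n n'] K[of n' n] that s hnorm_minus_commute[of "s n" "s n'"]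
      by (cases "n \<le> n'") (auto simp: hdist_def)
    then show "\<exists>N. \<forall>n n'. N \<le> n \<longrightarrow> N \<le> n' \<longrightarrow> hdist H (s n) (s n') < e" by blast
  qed (use s in auto)
  moreover have "metric.mcomplete" using hilbert_space by (simp add: hilbert_space_def)
  ultimately obtain l where "limitin (htopology H) s l sequentially"
    unfolding metric.mcomplete_def htopology_def by blast
  moreover from this have "l \<in> carrier H"
    unfolding htopology_def by (rule metric.limitin_mspace)
  ultimately show ?thesis using that limitin_iff_tends s by blast
qed

lemma dense_sequence:
  obtains d :: "nat \<Rightarrow> 'a" where "\<And>j. d j \<in> carrier H"
    "\<And>x e. \<lbrakk>x \<in> carrier H; 0 < e\<rbrakk> \<Longrightarrow> \<exists>j. hnorm H (x \<ominus> d j) < e"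
proof -
  obtain C where C: "countable C" "C \<subseteq> carrier H" "metric.mtopology closure_of C = carrier H"
    using hilbert_space unfolding hilbert_space_def separable_space_def htopology_def by auto
  have d: "\<exists>y\<in>C. hnorm H (x \<ominus> y) < e" if "x \<in> carrier H" "0 < e" for x e
  proof -
    have "\<exists>y\<in>C. y \<in> metric.mball x e" using C(3) that unfolding metric.metric_closure_of by blast
    then show ?thesis by (auto simp: hdist_def)
  qed
  then have "C \<noteq> {}" using d[OF zero_carrier zero_less_one] by blast
  then have r: "range (from_nat_into C) = C" using C(1) by (simp add: range_from_nat_into)
  show ?thesis
  proof (rule that[of "from_nat_into C"])
    show "from_nat_into C j \<in> carrier H" for j using C(2) r by blast
    show "\<exists>j. hnorm H (x \<ominus> from_nat_into C j) < e" if "x \<in> carrier H" "0 < e" for x e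
      using d[OF that] r by (metis rangeE)
  qed
qed

text \<open>The representing vector minimises the functional \<open>\<parallel>x\<parallel>\<^sup>2 - 2 Re (l x)\<close>.\<close>

theorem Riesz:
  assumes add: "\<And>x y. \<lbrakk>x \<in> carrier H; y \<in> carrier H\<rbrakk> \<Longrightarrow> l (x \<oplus> y) = l x + l y"
    and smult: "\<And>c x. x \<in> carrier H \<Longrightarrow> l (c \<odot> x) = c * l x"
    and bound: "\<And>x. x \<in> carrier H \<Longrightarrow> cmod (l x) \<le> C * hnorm H x"
  obtains w where "w \<in> carrier H" "\<And>x. x \<in> carrier H \<Longrightarrow> l x = ip H x w"
proof -
  define F where "F x = (hnorm H x)\<^sup>2 - 2 * Re (l x)" for x
  \<comment> \<open>Completing the square in \<open>hnorm H x\<close> bounds the functional from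
    below.\<close>
  have Fge: "- C\<^sup>2 \<le> F x" if "x \<in> carrier H" for x
  proof -
    have "Re (l x) \<le> C * hnorm H x"
      using bound[OF that] complex_Re_le_cmod order_trans by blast
    moreover have "0 \<le> (hnorm H x - C)\<^sup>2" by simp
    ultimately show ?thesis unfolding F_def by (simp add: power2_diff mult.commute)
  qed
  define m where "m = Inf (F ` carrier H)"
  have bdd: "bdd_below (F ` carrier H)" using Fge by (auto simp: bdd_below_def)
  have mle: "m \<le> F x" if "x \<in> carrier H" for x
    unfolding m_def using bdd that by (intro cInf_lower) auto
  have "\<exists>x\<in>carrier H. F x < m + 1 / real (Suc n)" for n
    using cInf_lessD[of "F ` carrier H" "m + 1 / real (Suc n)"] zero_carrier
    unfolding m_def by auto
  then obtain s where s: "\<And>n. s n \<in> carrier H" and Fs: "\<And>n. F (s n) < m + 1 / real (Suc n)"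
    by metis
  have expand: "F (x \<oplus> complex_of_real t \<odot> h) =
      F x + 2 * t * (Re (ip H x h) - Re (l h)) + t\<^sup>2 * (hnorm H h)\<^sup>2"
    if "x \<in> carrier H" "h \<in> carrier H" for x h t
    using that unfolding F_def
    by (simp add: hnorm_add_sq add smult power_mult_distrib algebra_simps)
  \<comment> \<open>The parallelogram law: the midpoint of \<open>s i\<close> and \<open>s j\<close>
    has value at least \<open>m\<close>, while both ends are below \<open>m + 1 / Suc i\<close>, so
    the ends must be close to each other.\<close>
  have quad: "(hnorm H (s i \<ominus> s j))\<^sup>2 \<le> 4 / real (Suc i)" if "i \<le> j" for i j
  proof -
    have mid: "m \<le> F ((1/2) \<odot> (s i \<oplus> s j))" using s by (intro mle) simp
    have "F ((1/2) \<odot> (s i \<oplus> s j)) =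
        (F (s i) + F (s j)) / 2 - (hnorm H (s i \<ominus> s j))\<^sup>2 / 4"
      using s unfolding F_def
      by (simp add: hnorm_add_sq hnorm_minus_sq add smult power_mult_distrib field_simps power2_eq_square[of 2])
    moreover have "1 / real (Suc j) \<le> 1 / real (Suc i)" using that by (simp add: frac_le)
    then have "F (s j) < m + 1 / real (Suc i)" using Fs[of j] by linarith
    ultimately have "(hnorm H (s i \<ominus> s j))\<^sup>2 / 4 < 1 / real (Suc i)"
      using mid Fs[of i] by argo
    then show ?thesis by simp
  qed
  obtain w where w: "w \<in> carrier H" "tends s w"
  proof (rule complete[OF s])
    fix e :: real assume e: "0 < e"
    then obtain K where K: "4 / e\<^sup>2 < real K" using reals_Archimedean2 by blast
    have "hnorm H (s i \<ominus> s j) < e" if "K \<le> i" "i \<le> j" for i j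
    proof -
      have "4 / e\<^sup>2 < real (Suc i)" using K that by simp
      then have "4 / real (Suc i) < e\<^sup>2" using e by (simp add: field_simps)
      then have "(hnorm H (s i \<ominus> s j))\<^sup>2 < e\<^sup>2" using quad[OF that(2)] by simp
      then show ?thesis by (rule power2_less_imp_less) (use e in simp)
    qed
    then show "\<exists>K. \<forall>i\<ge>K. \<forall>j\<ge>i. hnorm H (s i \<ominus> s j) < e" by blast
  qed
  have re: "Re (l h) = Re (ip H h w)" if h: "h \<in> carrier H" for h
  proof -
    have sq: "(Re (ip H (s n) h) - Re (l h))\<^sup>2 \<le> (hnorm H h)\<^sup>2 * (1 / real (Suc n))" for n
    proof -
      let ?b = "Re (ip H (s n) h) - Re (l h)"
      \<comment> \<open>Moving from the near-minimiser \<open>s n\<close> in direction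
        \<open>h\<close> cannot lower \<open>F\<close> by more than \<open>1 / Suc n\<close>. The
        discriminant of this quadratic in \<open>t\<close> then makes the derivative
        \<open>?b\<close> small.\<close>
      have q: "0 \<le> 1 / real (Suc n) + 2 * t * ?b + t\<^sup>2 * (hnorm H h)\<^sup>2" for t
        using mle[of "s n \<oplus> complex_of_real t \<odot> h"] Fs[of n] s h expand[of "s n" h t] by simp
      show ?thesis
      proof (cases "hnorm H h = 0")
        case True
        then have "l h = 0" "ip H (s n) h = 0"
          using bound[OF h] Cauchy_Schwarz[OF s[of n] h] unfolding True by simp_all
        then show ?thesis by simp
      next
        case False
        then have "0 < (hnorm H h)\<^sup>2" by simp
        then show ?thesis using nonneg_quadratic q by blast
      qed
    qed
    have "(\<lambda>n. (Re (ip H (s n) h) - Re (l h))\<^sup>2) \<longlonglongrightarrow> 0"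
    proof (rule Lim_null_comparison)
      show "\<forall>\<^sub>F n in sequentially. norm ((Re (ip H (s n) h) - Re (l h))\<^sup>2) \<le> (hnorm H h)\<^sup>2 * (1 / real (Suc n))"
        using sq by (intro always_eventually) simp
      show "(\<lambda>n. (hnorm H h)\<^sup>2 * (1 / real (Suc n))) \<longlonglongrightarrow> 0"
        using LIMSEQ_inverse_real_of_nat by (intro tendsto_mult_right_zero) (simp add: inverse_eq_divide)
    qed
    moreover have "(\<lambda>n. (Re (ip H (s n) h) - Re (l h))\<^sup>2) \<longlonglongrightarrow> (Re (ip H w h) - Re (l h))\<^sup>2"
      by (intro tendsto_intros tends_ip_left s w h)
    ultimately have "(Re (ip H w h) - Re (l h))\<^sup>2 = 0" by (rule LIMSEQ_unique[symmetric])
    then show ?thesis using ip_commute[OF w(1) h] by simp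
  qed
  show ?thesis
  proof (rule that[OF w(1)])
    fix x assume x: "x \<in> carrier H"
    show "l x = ip H x w"
      \<comment> \<open>For \<open>\<i> \<odot> x\<close>, equality of real parts is equality of
        imaginary parts for \<open>x\<close>.\<close>
      using re[OF x] re[of "\<i> \<odot> x"] x w smult[OF x, of \<i>] by (simp add: complex_eq_iff)
  qed
qed

text \<open>The bound is a parameter instead of being existentially quantified, because
  contractivity of the extended module requires the constant \<open>A_norm \<Omega> \<phi>\<close>
  itself.\<close>

definition bounded_linear_op :: "real \<Rightarrow> ('a \<Rightarrow> 'a) \<Rightarrow> bool"
  where "bounded_linear_op C T \<longleftrightarrow>
    T \<in> carrier H \<rightarrow> carrier H \<and>
    (\<forall>x\<in>carrier H. \<forall>y\<in>carrier H. T (x \<oplus> y) = T x \<oplus> T y) \<and>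
    (\<forall>c. \<forall>x\<in>carrier H. T (c \<odot> x) = c \<odot> T x) \<and>
    (\<forall>x\<in>carrier H. hnorm H (T x) \<le> C * hnorm H x)"

lemma bounded_linear_opD:
  assumes "bounded_linear_op C T"
  shows "x \<in> carrier H \<Longrightarrow> T x \<in> carrier H"
    and "\<lbrakk>x \<in> carrier H; y \<in> carrier H\<rbrakk> \<Longrightarrow> T (x \<oplus> y) = T x \<oplus> T y"
    and "x \<in> carrier H \<Longrightarrow> T (c \<odot> x) = c \<odot> T x"
    and "x \<in> carrier H \<Longrightarrow> hnorm H (T x) \<le> C * hnorm H x"
  using assms unfolding bounded_linear_op_def by auto

lemma bounded_linear_op_minus:
  assumes T: "bounded_linear_op C T" and x: "x \<in> carrier H" "y \<in> carrier H"
  shows "T (x \<ominus> y) = T x \<ominus> T y"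
proof -
  show ?thesis using x bounded_linear_opD[OF T] by (simp add: minus_eq_add_smult)
qed

lemma bounded_linear_op_tends:
  assumes T: "bounded_linear_op C T" and s: "\<And>k. s k \<in> carrier H" "l \<in> carrier H" "tends s l"
  shows "tends (\<lambda>k. T (s k)) (T l)"
  unfolding tends_def
proof (rule Lim_null_comparison)
  show "\<forall>\<^sub>F k in sequentially. norm (hnorm H (T (s k) \<ominus> T l)) \<le> C * hnorm H (s k \<ominus> l)"
  proof (intro always_eventually allI)
    fix k
    have "hnorm H (T (s k \<ominus> l)) \<le> C * hnorm H (s k \<ominus> l)"
      using bounded_linear_opD(4)[OF T] s by simp
    then show "norm (hnorm H (T (s k) \<ominus> T l)) \<le> C * hnorm H (s k \<ominus> l)"
      using bounded_linear_opD(1)[OF T] bounded_linear_op_minus[OF T] s by simp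
  qed
  show "(\<lambda>k. C * hnorm H (s k \<ominus> l)) \<longlonglongrightarrow> 0"
    using s(3) unfolding tends_def by (rule tendsto_mult_right_zero)
qed

lemma adj_eqI:
  assumes T: "\<And>x. x \<in> carrier H \<Longrightarrow> T x \<in> carrier H" and y: "y \<in> carrier H" and w: "w \<in> carrier H"
    and eq: "\<And>x. x \<in> carrier H \<Longrightarrow> ip H (T x) y = ip H x w"
  shows "adj H T y = w"
  unfolding adj_def
proof (rule the_equality)
  fix v assume "v \<in> carrier H \<and> (\<forall>x\<in>carrier H. ip H (T x) y = ip H x v)"
  then show "v = w" using eq w by (intro vec_eqI_right) auto
qed (use w eq in auto)

lemma adj:
  assumes T: "bounded_linear_op C T" and C: "0 \<le> C" and y: "y \<in> carrier H"
  shows adj_carrier: "adj H T y \<in> carrier H"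
    and ip_adj: "x \<in> carrier H \<Longrightarrow> ip H x (adj H T y) = ip H (T x) y"
proof -
  obtain w where w: "w \<in> carrier H" "\<And>x. x \<in> carrier H \<Longrightarrow> ip H (T x) y = ip H x w"
  proof (rule Riesz[of "\<lambda>x. ip H (T x) y" "C * hnorm H y"])
    show "cmod (ip H (T x) y) \<le> C * hnorm H y * hnorm H x" if "x \<in> carrier H" for x
    proof -
      have "cmod (ip H (T x) y) \<le> hnorm H (T x) * hnorm H y"
        using Cauchy_Schwarz bounded_linear_opD[OF T] y that by blast
      also have "\<dots> \<le> (C * hnorm H x) * hnorm H y"
        using bounded_linear_opD(4)[OF T] that y by (intro mult_right_mono) auto
      finally show ?thesis by (simp add: mult_ac)
    qed
  qed (use y bounded_linear_opD[OF T] in auto)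
  have "adj H T y = w" using bounded_linear_opD[OF T] y w by (intro adj_eqI) auto
  then show "adj H T y \<in> carrier H" "x \<in> carrier H \<Longrightarrow> ip H x (adj H T y) = ip H (T x) y"
    using w by auto
qed

lemma ip_adj_left:
  assumes "bounded_linear_op C T" "0 \<le> C" "x \<in> carrier H" "y \<in> carrier H"
  shows "ip H (adj H T y) x = ip H y (T x)"
  using assms ip_adj[OF assms(1,2,4,3)] adj_carrier[OF assms(1,2,4)] bounded_linear_opD(1)[OF assms(1)]
  by (metis ip_commute)

text \<open>The norm bound comes from estimating the squared norm of \<open>adj H T x\<close>,
  written as the inner product of \<open>x\<close> with \<open>T (adj H T x)\<close>, and cancelling
  one factor.\<close>

lemma bounded_linear_op_adj:
  assumes T: "bounded_linear_op C T" and C: "0 \<le> C"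
  shows "bounded_linear_op C (adj H T)"
  unfolding bounded_linear_op_def
proof (intro conjI ballI allI Pi_I)
  note [simp] = adj_carrier[OF T C] ip_adj_left[OF T C] bounded_linear_opD(1)[OF T]
  fix x assume x: "x \<in> carrier H"
  then show "adj H T x \<in> carrier H" by simp
  show "adj H T (x \<oplus> y) = adj H T x \<oplus> adj H T y" if "y \<in> carrier H" for y
    by (rule vec_eqI) (use x that in auto)
  show "adj H T (c \<odot> x) = c \<odot> adj H T x" for c
    by (rule vec_eqI) (use x in auto)
  let ?a = "hnorm H (adj H T x)"
  have "?a * ?a = cmod (ip H (adj H T x) (adj H T x))"
    using x by (simp add: ip_self norm_mult power2_eq_square del: ip_adj_left)
  also have "\<dots> = cmod (ip H x (T (adj H T x)))" using x by simp
  also have "\<dots> \<le> hnorm H x * hnorm H (T (adj H T x))" using x by (intro Cauchy_Schwarz) auto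
  also have "\<dots> \<le> hnorm H x * (C * ?a)"
    using x bounded_linear_opD(4)[OF T] by (intro mult_left_mono) auto
  finally have "?a * ?a \<le> (C * hnorm H x) * ?a" by (simp add: mult_ac)
  moreover have "0 \<le> ?a" "0 \<le> C * hnorm H x" using x C by simp_all
  ultimately show "?a \<le> C * hnorm H x" by (metis mult_le_cancel_right_pos order_le_less)
qed

lemma bounded_linear_op_compose:
  assumes T: "bounded_linear_op C T" and S: "bounded_linear_op D S" and C: "0 \<le> C"
  shows "bounded_linear_op (C * D) (\<lambda>x. T (S x))"
  unfolding bounded_linear_op_def
proof (intro conjI ballI allI Pi_I)
  fix x assume x: "x \<in> carrier H"
  have "hnorm H (T (S x)) \<le> C * hnorm H (S x)"
    using x bounded_linear_opD[OF T] bounded_linear_opD[OF S] by blast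
  also have "\<dots> \<le> C * (D * hnorm H x)"
    using x C bounded_linear_opD[OF S] by (intro mult_left_mono) auto
  finally show "hnorm H (T (S x)) \<le> C * D * hnorm H x" by (simp add: mult.assoc)
qed (use bounded_linear_opD[OF T] bounded_linear_opD[OF S] in auto)

lemma bounded_linear_op_funpow:
  assumes "bounded_linear_op 1 T"
  shows "bounded_linear_op 1 (T ^^ k)"
proof (induction k)
  case 0
  show ?case by (simp add: bounded_linear_op_def)
next
  case (Suc k)
  show ?case using bounded_linear_op_compose[OF assms Suc] by (simp add: o_def)
qed

text \<open>Otherwise some subsequence stays away from 0, and along a further one
  \<open>K (y k)\<close> converges in norm to some \<open>l\<close>. There the inner product splits
  into that of \<open>K (y k) \<ominus> l\<close> with \<open>y k\<close>, small because
  \<open>y k\<close> is bounded, and that of \<open>l\<close> with \<open>y k\<close>, small by weak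
  convergence.\<close>

lemma compact_op_weakly_null:
  assumes K: "compact_op H K"
    and y: "\<And>k. y k \<in> carrier H" "\<And>k. hnorm H (y k) \<le> 1"
    and weak: "\<And>z. z \<in> carrier H \<Longrightarrow> (\<lambda>k. ip H (y k) z) \<longlonglongrightarrow> 0"
  shows "(\<lambda>k. ip H (K (y k)) (y k)) \<longlonglongrightarrow> 0"
proof (rule ccontr)
  have Kc [simp]: "x \<in> carrier H \<Longrightarrow> K x \<in> carrier H" for x
    using K unfolding compact_op_def by auto
  let ?f = "\<lambda>k. ip H (K (y k)) (y k)"
  assume "\<not> ?f \<longlonglongrightarrow> 0"
  then obtain e where e: "0 < e" "\<And>N. \<exists>n\<ge>N. e \<le> cmod (?f n)"
    unfolding LIMSEQ_iff by (auto simp: not_less)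
  then have "infinite {n. e \<le> cmod (?f n)}" by (auto simp: infinite_nat_iff_unbounded_le)
  then obtain r :: "nat \<Rightarrow> nat" where r: "strict_mono r" "\<And>n. e \<le> cmod (?f (r n))"
    using infinite_enumerate[of "{n. e \<le> cmod (?f n)}"] by auto
  let ?S = "htopology H closure_of (K ` {x \<in> carrier H. hnorm H x \<le> 1})"
  have "K ` {x \<in> carrier H. hnorm H x \<le> 1} \<subseteq> ?S"
    by (rule closure_of_subset) (auto simp: htopology_def)
  then have "range (\<lambda>n. K (y (r n))) \<subseteq> ?S" using y by auto
  moreover have "compactin metric.mtopology ?S" using K by (simp add: compact_op_def htopology_def)
  ultimately obtain l q where q: "strict_mono (q :: nat \<Rightarrow> nat)"
    and lim: "limitin (htopology H) ((\<lambda>n. K (y (r n))) \<circ> q) l sequentially"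
    unfolding metric.compactin_sequentially htopology_def by meson
  have l [simp]: "l \<in> carrier H" using lim unfolding htopology_def by (rule metric.limitin_mspace)
  define p where "p = r \<circ> q"
  have p: "strict_mono p" unfolding p_def using r(1) q by (rule strict_mono_o)
  have tends: "tends (\<lambda>n. K (y (p n))) l"
    using lim y by (subst (asm) limitin_iff_tends) (auto simp: p_def o_def)
  have "(\<lambda>n. ip H (K (y (p n)) \<ominus> l) (y (p n))) \<longlonglongrightarrow> 0"
  proof (rule Lim_null_comparison)
    have "cmod (ip H (K (y (p n)) \<ominus> l) (y (p n))) \<le> hnorm H (K (y (p n)) \<ominus> l) * 1" for n
      using y by (intro order_trans[OF Cauchy_Schwarz mult_left_mono]) auto
    then show "\<forall>\<^sub>F n in sequentially.
        norm (ip H (K (y (p n)) \<ominus> l) (y (p n))) \<le> hnorm H (K (y (p n)) \<ominus> l)"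
      by (intro always_eventually) simp
  qed (use tends in \<open>simp add: tends_def\<close>)
  moreover have "(\<lambda>n. ip H l (y (p n))) \<longlonglongrightarrow> 0"
  proof -
    have "(\<lambda>n. cnj (ip H (y (p n)) l)) \<longlonglongrightarrow> cnj 0"
      using LIMSEQ_subseq_LIMSEQ[OF weak[OF l] p] by (intro tendsto_cnj) (simp add: o_def)
    then show ?thesis using ip_commute[OF y(1) l] by simp
  qed
  ultimately have "(\<lambda>n. ip H (K (y (p n)) \<ominus> l) (y (p n)) + ip H l (y (p n))) \<longlonglongrightarrow> 0 + 0"
    by (rule tendsto_add)
  then have "(\<lambda>n. ?f (p n)) \<longlonglongrightarrow> 0" using y by simp
  then obtain N where "cmod (?f (p N)) < e" using e(1) unfolding LIMSEQ_iff by auto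
  then show False using r(2)[of "q N"] by (simp add: p_def)
qed

end

section \<open>Isometries\<close>

locale isometry = hilbert H for H :: "('a, 'm) inner_space_scheme" (structure) +
  fixes U :: "'a \<Rightarrow> 'a"
  assumes U_carrier [simp, intro]: "x \<in> carrier H \<Longrightarrow> U x \<in> carrier H"
    and U_add: "\<lbrakk>x \<in> carrier H; y \<in> carrier H\<rbrakk> \<Longrightarrow> U (x \<oplus> y) = U x \<oplus> U y"
    and U_smult: "x \<in> carrier H \<Longrightarrow> U (c \<odot> x) = c \<odot> U x"
    and hnorm_U [simp]: "x \<in> carrier H \<Longrightarrow> hnorm H (U x) = hnorm H x"
begin

abbreviation "Us \<equiv> adj H U"

lemma U_op: "bounded_linear_op 1 U"
  unfolding bounded_linear_op_def by (simp add: U_add U_smult Pi_def)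

lemmas Us_op = bounded_linear_op_adj[OF U_op zero_le_one]

lemmas Us_carrier [simp, intro] = adj_carrier[OF U_op zero_le_one]

lemmas ip_Us = ip_adj[OF U_op zero_le_one] ip_adj_left[OF U_op zero_le_one]

lemma ip_U_U [simp]:
  assumes "x \<in> carrier H" "y \<in> carrier H"
  shows "ip H (U x) (U y) = ip H x y"
proof -
  have "ip H (U x) (U y) - ip H x y = 0"
  proof (rule polarization[where Q = "\<lambda>x y. ip H (U x) (U y) - ip H x y"])
    show "ip H (U x) (U x) - ip H x x = 0" if "x \<in> carrier H" for x
      using that ip_self[of "U x"] ip_self[of x] by simp
  qed (use assms in \<open>auto simp: U_add U_smult algebra_simps\<close>)
  then show ?thesis by simp
qed

lemma Us_U [simp]: "x \<in> carrier H \<Longrightarrow> Us (U x) = x"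
  by (rule vec_eqI) (simp_all add: ip_Us)

lemma pow_carrier [simp, intro]:
  "x \<in> carrier H \<Longrightarrow> (U ^^ k) x \<in> carrier H" "x \<in> carrier H \<Longrightarrow> (Us ^^ k) x \<in> carrier H"
  by (induction k) auto

lemma hnorm_U_pow [simp]: "x \<in> carrier H \<Longrightarrow> hnorm H ((U ^^ k) x) = hnorm H x"
  by (induction k) auto

lemma ip_U_pow_pow [simp]:
  "\<lbrakk>x \<in> carrier H; y \<in> carrier H\<rbrakk> \<Longrightarrow> ip H ((U ^^ k) x) ((U ^^ k) y) = ip H x y"
  by (induction k) auto

lemma Us_pow_U_pow [simp]: "x \<in> carrier H \<Longrightarrow> (Us ^^ k) ((U ^^ k) x) = x"
proof (induction k)
  case (Suc k)
  then show ?case using Us_U[of "(U ^^ k) x"] by (simp add: funpow_swap1[of Us])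
qed simp

lemma ip_Us_pow:
  assumes "x \<in> carrier H" "y \<in> carrier H"
  shows "ip H x ((Us ^^ k) y) = ip H ((U ^^ k) x) y"
  using assms
proof (induction k arbitrary: x)
  case (Suc k)
  then show ?case by (simp add: ip_Us funpow_swap1[of U])
qed simp

lemma ip_Us_pow_left:
  assumes "x \<in> carrier H" "y \<in> carrier H"
  shows "ip H ((Us ^^ k) y) x = ip H y ((U ^^ k) x)"
  using assms ip_Us_pow[OF assms, of k] by (metis ip_commute pow_carrier)

lemma hnorm_Us_le: "x \<in> carrier H \<Longrightarrow> hnorm H (Us x) \<le> hnorm H x"
  using bounded_linear_opD(4)[OF Us_op] by simp

text \<open>Pythagoras for the projections onto the nested ranges of \<open>U ^^ j\<close> and
  \<open>U ^^ k\<close>; it turns convergence of the norms into the Cauchy property of the projected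
  vectors.\<close>

lemma proj_dist_sq:
  assumes x: "x \<in> carrier H" and "j \<le> k"
  shows "(hnorm H ((U ^^ j) ((Us ^^ j) x) \<ominus> (U ^^ k) ((Us ^^ k) x)))\<^sup>2 =
    (hnorm H ((Us ^^ j) x))\<^sup>2 - (hnorm H ((Us ^^ k) x))\<^sup>2"
proof -
  \<comment> \<open>Two splittings of \<open>k\<close>: one puts \<open>Us ^^ j\<close> innermost in
    \<open>Us ^^ k\<close>, the other puts \<open>U ^^ j\<close> outermost in \<open>U ^^ k\<close>,
    where it cancels.\<close>
  have k: "k = (k - j) + j" "k = j + (k - j)" using assms by auto
  have "ip H ((U ^^ j) ((Us ^^ j) x)) ((U ^^ k) ((Us ^^ k) x)) =
    ip H ((Us ^^ (k - j)) ((Us ^^ j) x)) ((Us ^^ k) x)"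
    using x by (subst k(2)) (simp add: funpow_add ip_Us_pow_left)
  also have "(Us ^^ (k - j)) ((Us ^^ j) x) = (Us ^^ k) x"
    by (subst (2) k(1)) (simp only: funpow_add o_apply)
  finally show ?thesis using x by (simp add: hnorm_minus_sq ip_self)
qed

text \<open>The vectors \<open>U^k (U*^k x)\<close> are the projections of \<open>x\<close> to the decreasing ranges of \<open>U^k\<close>.\<close>

lemma pure_Us_pow_tendsto_0:
  assumes pure: "(\<Inter>k::nat. (U ^^ k) ` carrier H) = {\<zero>}" and x: "x \<in> carrier H"
  shows "(\<lambda>k. hnorm H ((Us ^^ k) x)) \<longlonglongrightarrow> 0"
proof -
  define p where "p k = (U ^^ k) ((Us ^^ k) x)" for k
  have p [simp]: "p k \<in> carrier H" for k unfolding p_def using x by simp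
  \<comment> \<open>A decreasing sequence of squared norms is Cauchy, and its differences are the
    squared distances between the projections.\<close>
  have "decseq (\<lambda>k. (hnorm H ((Us ^^ k) x))\<^sup>2)"
    using x hnorm_Us_le by (intro decseq_SucI power_mono) auto
  then obtain c where "(\<lambda>k. (hnorm H ((Us ^^ k) x))\<^sup>2) \<longlonglongrightarrow> c"
    using decseq_convergent[of _ 0] by (metis zero_le_power2)
  then have cauchy: "Cauchy (\<lambda>k. (hnorm H ((Us ^^ k) x))\<^sup>2)" by (rule LIMSEQ_imp_Cauchy)
  obtain l where l: "l \<in> carrier H" "tends p l"
  proof (rule complete[of p])
    fix e :: real assume e: "0 < e"
    obtain K where K: "\<And>m n. K \<le> m \<Longrightarrow> K \<le> n \<Longrightarrow>
        dist ((hnorm H ((Us ^^ m) x))\<^sup>2) ((hnorm H ((Us ^^ n) x))\<^sup>2) < e\<^sup>2"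
      using cauchy e unfolding Cauchy_def by (meson zero_less_power)
    have "hnorm H (p m \<ominus> p n) < e" if "K \<le> m" "m \<le> n" for m n
    proof (rule power2_less_imp_less)
      show "(hnorm H (p m \<ominus> p n))\<^sup>2 < e\<^sup>2"
        using K[of m n] that unfolding p_def proj_dist_sq[OF x that(2)] by (simp add: dist_real_def)
    qed (use e in simp)
    then show "\<exists>K. \<forall>m\<ge>K. \<forall>n\<ge>m. hnorm H (p m \<ominus> p n) < e" by blast
  qed simp
  \<comment> \<open>From index \<open>m\<close> on the projections lie in the range of
    \<open>U ^^ m\<close> and are fixed by the projection onto it. By continuity so is
    \<open>l\<close>, which therefore lies in every range.\<close>
  have "l \<in> (U ^^ m) ` carrier H" for m
  proof -
    have op: "bounded_linear_op 1 (\<lambda>y. (U ^^ m) ((Us ^^ m) y))"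
      using bounded_linear_op_compose[OF bounded_linear_op_funpow[OF U_op, of m]
        bounded_linear_op_funpow[OF Us_op, of m] zero_le_one] by simp
    have fixp: "(U ^^ m) ((Us ^^ m) (p (k + m))) = p (k + m)" for k
      unfolding p_def using x by (simp add: funpow_add add.commute[of k m])
    have l': "tends (\<lambda>k. p (k + m)) l"
      using l(2) unfolding tends_def by (rule LIMSEQ_ignore_initial_segment)
    then have "tends (\<lambda>k. (U ^^ m) ((Us ^^ m) (p (k + m)))) ((U ^^ m) ((Us ^^ m) l))"
      using l by (intro bounded_linear_op_tends[OF op]) auto
    then have l'': "tends (\<lambda>k. p (k + m)) ((U ^^ m) ((Us ^^ m) l))" by (simp add: fixp)
    have "l = (U ^^ m) ((Us ^^ m) l)"
      by (rule vec_eqI) (use l LIMSEQ_unique[OF tends_ip_left[OF _ _ l'] tends_ip_left[OF _ _ l'']] in auto)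
    then show ?thesis using l(1) by blast
  qed
  then have "l = \<zero>" using pure by blast
  then have "(\<lambda>k. hnorm H (p k)) \<longlonglongrightarrow> 0" using tends_hnorm[OF p l] by simp
  then show ?thesis using x by (simp add: p_def)
qed

text \<open>Moving the power to the other argument reduces this to strong convergence of
  \<open>(Us ^^ k) z\<close>.\<close>

lemma pure_weakly_null:
  assumes pure: "(\<Inter>k::nat. (U ^^ k) ` carrier H) = {\<zero>}" and x: "x \<in> carrier H" and z: "z \<in> carrier H"
  shows "(\<lambda>k. ip H ((U ^^ k) x) z) \<longlonglongrightarrow> 0"
proof (rule Lim_null_comparison)
  show "\<forall>\<^sub>F k in sequentially. norm (ip H ((U ^^ k) x) z) \<le> hnorm H x * hnorm H ((Us ^^ k) z)"
    using x z Cauchy_Schwarz[OF x] by (intro always_eventually) (simp add: ip_Us_pow[symmetric])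
  show "(\<lambda>k. hnorm H x * hnorm H ((Us ^^ k) z)) \<longlonglongrightarrow> 0"
    by (rule tendsto_mult_right_zero[OF pure_Us_pow_tendsto_0[OF pure z]])
qed

end

section \<open>The minimal unitary extension of an isometry\<close>

text \<open>The extension space is realised as the inverse limit of \<open>H\<close> under \<open>U*\<close>: a vector \<open>y\<close> of the
  extension corresponds to the sequence of the projections of \<open>W^k y\<close> to \<open>H\<close>, where \<open>W\<close> is the
  unitary extension of \<open>U\<close>. Testing against a dense sequence \<open>d\<close> turns these sequences into
  sequences of complex numbers.\<close>

locale dense_isometry = isometry H U for H :: "('a, 'm) inner_space_scheme" (structure) and U +
  fixes d :: "nat \<Rightarrow> 'a"
  assumes d_carrier [simp, intro]: "d j \<in> carrier H"
    and d_dense: "\<lbrakk>x \<in> carrier H; 0 < e\<rbrakk> \<Longrightarrow> \<exists>j. hnorm H (x \<ominus> d j) < e"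
begin

section \<open>Coherent sequences and their limiting inner product\<close>

definition coherent :: "(nat \<Rightarrow> 'a) \<Rightarrow> bool"
  where "coherent a \<longleftrightarrow> (\<forall>k. a k \<in> carrier H) \<and> (\<forall>k. Us (a (Suc k)) = a k) \<and>
    (\<exists>B. \<forall>k. hnorm H (a k) \<le> B)"

lemma coherentI:
  assumes "\<And>k. a k \<in> carrier H" "\<And>k. Us (a (Suc k)) = a k" "\<And>k. hnorm H (a k) \<le> B"
  shows "coherent a"
  using assms unfolding coherent_def by blast

lemma coherentD:
  assumes "coherent a"
  shows coherent_carrier: "a k \<in> carrier H" and coherent_Us: "Us (a (Suc k)) = a k"
  using assms unfolding coherent_def by auto

lemma coherent_Us_pow:
  assumes "coherent a"
  shows "(Us ^^ j) (a (k + j)) = a k"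
proof (induction j)
  case (Suc j)
  then show ?case using coherent_Us[OF assms] by (simp add: funpow_swap1)
qed simp

lemma coherent_add:
  assumes a: "coherent a" and b: "coherent b"
  shows "coherent (\<lambda>k. a k \<oplus> b k)"
proof -
  obtain A B where AB: "\<And>k. hnorm H (a k) \<le> A" "\<And>k. hnorm H (b k) \<le> B"
    using a b unfolding coherent_def by blast
  show ?thesis
  proof (rule coherentI[where B = "A + B"])
    show "hnorm H (a k \<oplus> b k) \<le> A + B" for k
      using hnorm_triangle[OF coherent_carrier[OF a, of k] coherent_carrier[OF b, of k]] AB[of k] by simp
  qed (use bounded_linear_opD[OF Us_op] coherentD[OF a] coherentD[OF b] in auto)
qed

lemma coherent_smult:
  assumes a: "coherent a"
  shows "coherent (\<lambda>k. c \<odot> a k)"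
proof -
  obtain A where A: "\<And>k. hnorm H (a k) \<le> A" using a unfolding coherent_def by blast
  show ?thesis
    by (rule coherentI[where B = "cmod c * A"])
      (use bounded_linear_opD[OF Us_op] coherentD[OF a] A in \<open>auto intro: mult_left_mono\<close>)
qed

lemma coherent_minus: "\<lbrakk>coherent a; coherent b\<rbrakk> \<Longrightarrow> coherent (\<lambda>k. a k \<ominus> b k)"
  using coherent_add[OF _ coherent_smult, of a b "-1"] by (simp add: minus_eq_add_smult coherent_carrier)

lemma coherent_zero: "coherent (\<lambda>k. \<zero>)"
proof (rule coherentI[where B = 0])
  show "Us \<zero> = \<zero>" by (rule vec_eqI) (auto simp: ip_Us)
qed auto

text \<open>Each entry is the image of the next under the contraction \<open>Us\<close>. This
  monotonicity, together with boundedness, is the source of all limits taken for coherent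
  sequences.\<close>

lemma coherent_incseq: "coherent a \<Longrightarrow> incseq (\<lambda>k. hnorm H (a k))"
  using hnorm_Us_le[OF coherent_carrier[of a]] coherent_Us[of a] by (intro incseq_SucI) metis

lemma coherent_convergent:
  assumes "coherent a"
  obtains L where "(\<lambda>k. hnorm H (a k)) \<longlonglongrightarrow> L"
proof -
  obtain B where "\<forall>k. hnorm H (a k) \<le> B" using assms unfolding coherent_def by blast
  then show ?thesis using incseq_convergent[OF coherent_incseq[OF assms]] that by blast
qed

text \<open>The inner product of the extension: the projections onto \<open>W^-k H\<close> tend
  strongly to the identity, so the inner products of the \<open>k\<close>-th coordinates tend to
  that of the vectors.\<close>

definition lim_ip :: "(nat \<Rightarrow> 'a) \<Rightarrow> (nat \<Rightarrow> 'a) \<Rightarrow> complex"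
  where "lim_ip a b = lim (\<lambda>k. ip H (a k) (b k))"

lemma lim_ip_eqI: "(\<lambda>k. ip H (a k) (b k)) \<longlonglongrightarrow> c \<Longrightarrow> lim_ip a b = c"
  unfolding lim_ip_def by (rule limI)

text \<open>On the diagonal the squared norms converge by monotonicity; polarization reduces the
  general case to four diagonal ones.\<close>

lemma lim_ip_tendsto:
  assumes a: "coherent a" and b: "coherent b"
  shows "(\<lambda>k. ip H (a k) (b k)) \<longlonglongrightarrow> lim_ip a b"
proof -
  have self: "convergent (\<lambda>k. ip H (c k) (c k))" if c: "coherent c" for c
  proof -
    obtain L where "(\<lambda>k. hnorm H (c k)) \<longlonglongrightarrow> L" using coherent_convergent[OF c] .
    then have "(\<lambda>k. complex_of_real ((hnorm H (c k))\<^sup>2)) \<longlonglongrightarrow> complex_of_real (L\<^sup>2)"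
      by (intro tendsto_intros)
    then show ?thesis unfolding ip_self[OF coherent_carrier[OF c], symmetric] by (rule convergentI)
  qed
  have "convergent (\<lambda>k. (ip H (a k \<oplus> b k) (a k \<oplus> b k) - ip H (a k \<ominus> b k) (a k \<ominus> b k)
    + \<i> * ip H (a k \<oplus> \<i> \<odot> b k) (a k \<oplus> \<i> \<odot> b k)
    - \<i> * ip H (a k \<ominus> \<i> \<odot> b k) (a k \<ominus> \<i> \<odot> b k)) / 4)"
    unfolding divide_inverse
    by (intro convergent_mult convergent_diff convergent_add convergent_const self
        coherent_add coherent_minus coherent_smult a b)
  then have "convergent (\<lambda>k. ip H (a k) (b k))"
    unfolding ip_polar[OF coherent_carrier[OF a] coherent_carrier[OF b], symmetric] .
  then show ?thesis unfolding lim_ip_def by (simp add: convergent_LIMSEQ_iff)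
qed

section \<open>The limit space as a space of complex sequences\<close>

definition code :: "(nat \<Rightarrow> 'a) \<Rightarrow> nat \<Rightarrow> complex"
  where "code a n = ip H (a (fst (prod_decode n))) (d (snd (prod_decode n)))"

definition decode :: "(nat \<Rightarrow> complex) \<Rightarrow> nat \<Rightarrow> 'a"
  where "decode = inv_into (Collect coherent) code"

text \<open>Some \<open>d j\<close> is closer to a nonzero \<open>x\<close> than 0 is. As it is
  orthogonal to \<open>x\<close>, this contradicts Cauchy-Schwarz for \<open>x\<close> and
  \<open>x \<ominus> d j\<close>.\<close>

lemma eq_zero_if_orthogonal:
  assumes x: "x \<in> carrier H" and d: "\<And>j. ip H x (d j) = 0"
  shows "x = \<zero>"
proof (rule ccontr)
  assume "x \<noteq> \<zero>"
  then have pos: "0 < hnorm H x" using x by (metis hnorm_eq_0 hnorm_ge_0 order_le_less)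
  then obtain j where j: "hnorm H (x \<ominus> d j) < hnorm H x" using d_dense x by blast
  have "hnorm H x * hnorm H x = cmod (ip H x (x \<ominus> d j))"
    using x d by (simp add: ip_self norm_mult power2_eq_square)
  also have "\<dots> \<le> hnorm H x * hnorm H (x \<ominus> d j)" using x by (intro Cauchy_Schwarz) auto
  also have "\<dots> < hnorm H x * hnorm H x" using j pos by simp
  finally show False by simp
qed

lemma inj_code: "inj_on code (Collect coherent)"
proof (rule inj_onI, rule ext)
  fix a b k assume "a \<in> Collect coherent" "b \<in> Collect coherent" and eq: "code a = code b"
  then have ab [simp]: "a k \<in> carrier H" "b k \<in> carrier H" for k by (auto simp: coherent_carrier)
  have "ip H (a k \<ominus> b k) (d j) = 0" for j
    using fun_cong[OF eq, of "prod_encode (k, j)"] by (simp add: code_def)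
  then have "a k \<ominus> b k = \<zero>" by (intro eq_zero_if_orthogonal) auto
  then show "a k = b k" by simp
qed

lemma decode_code [simp]: "coherent a \<Longrightarrow> decode (code a) = a"
  unfolding decode_def using inv_into_f_f[OF inj_code] by simp

lemma code_add: "\<lbrakk>coherent a; coherent b\<rbrakk> \<Longrightarrow> code (\<lambda>k. a k \<oplus> b k) = (\<lambda>n. code a n + code b n)"
  by (simp add: code_def fun_eq_iff coherent_carrier)

lemma code_smult: "coherent a \<Longrightarrow> code (\<lambda>k. c \<odot> a k) = (\<lambda>n. c * code a n)"
  by (simp add: code_def fun_eq_iff coherent_carrier)

lemma code_zero: "code (\<lambda>k. \<zero>) = (\<lambda>n. 0)"
  by (simp add: code_def fun_eq_iff)

text \<open>The action is a parameter because the intended one is an adjoint, which presupposes this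
  Hilbert space. The vector operations can be pointwise since \<open>code\<close> is linear.\<close>

definition limit_space ::
    "(((complex ^ 'n::finite) \<Rightarrow> complex) \<Rightarrow> (nat \<Rightarrow> complex) \<Rightarrow> nat \<Rightarrow> complex)
      \<Rightarrow> (nat \<Rightarrow> complex, 'n) hilbert_module"
  where "limit_space A =
    \<lparr>carrier = code ` Collect coherent, mult = undefined, one = undefined, zero = (\<lambda>n. 0),
     add = (\<lambda>f g n. f n + g n), smult = (\<lambda>c f n. c * f n),
     ip = (\<lambda>f g. lim_ip (decode f) (decode g)), act = A\<rparr>"

lemma limit_space_carrier: "carrier (limit_space A) = code ` Collect coherent"
  by (simp add: limit_space_def)

lemma code_carrier [simp, intro]: "coherent a \<Longrightarrow> code a \<in> carrier (limit_space A)"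
  by (simp add: limit_space_carrier)

lemma limit_space_cases:
  assumes "f \<in> carrier (limit_space A)"
  obtains a where "coherent a" "f = code a"
  using assms by (auto simp: limit_space_carrier)

lemma limit_space_add:
  "\<lbrakk>coherent a; coherent b\<rbrakk> \<Longrightarrow> code a \<oplus>\<^bsub>limit_space A\<^esub> code b = code (\<lambda>k. a k \<oplus> b k)"
  by (simp add: limit_space_def code_add)

lemma limit_space_smult: "coherent a \<Longrightarrow> c \<odot>\<^bsub>limit_space A\<^esub> code a = code (\<lambda>k. c \<odot> a k)"
  by (simp add: limit_space_def code_smult)

lemma limit_space_zero: "\<zero>\<^bsub>limit_space A\<^esub> = code (\<lambda>k. \<zero>)"
  by (simp add: limit_space_def code_zero)

lemma ip_limit_space [simp]:
  "\<lbrakk>coherent a; coherent b\<rbrakk> \<Longrightarrow> ip (limit_space A) (code a) (code b) = lim_ip a b"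
  by (simp add: limit_space_def)

lemma module_limit_space: "Module.module complex_ring (limit_space A)"
proof (rule moduleI[OF cring_complex_ring])
  note [simp] = limit_space_def complex_ring_def
  show "abelian_group (limit_space A)"
  proof (rule abelian_groupI)
    show "\<zero>\<^bsub>limit_space A\<^esub> \<in> carrier (limit_space A)"
      using coherent_zero by (simp only: limit_space_zero code_carrier)
    show "f \<oplus>\<^bsub>limit_space A\<^esub> g \<in> carrier (limit_space A)"
      if "f \<in> carrier (limit_space A)" "g \<in> carrier (limit_space A)" for f g
      using that by (elim limit_space_cases) (simp only: limit_space_add coherent_add code_carrier)
    show "\<exists>g\<in>carrier (limit_space A). g \<oplus>\<^bsub>limit_space A\<^esub> f = \<zero>\<^bsub>limit_space A\<^esub>"
      if f: "f \<in> carrier (limit_space A)" for f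
    proof -
      obtain a where a: "coherent a" "f = code a" using f by (rule limit_space_cases)
      have "code (\<lambda>k. (-1) \<odot> a k) \<in> carrier (limit_space A)"
        by (rule code_carrier[OF coherent_smult[OF a(1)]])
      moreover have "code (\<lambda>k. (-1) \<odot> a k) \<oplus>\<^bsub>limit_space A\<^esub> f = \<zero>\<^bsub>limit_space A\<^esub>"
        using a by (simp add: code_smult)
      ultimately show ?thesis by blast
    qed
  qed (simp_all add: add_ac)
  show "c \<odot>\<^bsub>limit_space A\<^esub> f \<in> carrier (limit_space A)" if "f \<in> carrier (limit_space A)" for c f
    using that by (elim limit_space_cases) (simp only: limit_space_smult coherent_smult code_carrier)
qed (simp_all add: limit_space_def complex_ring_def algebra_simps)

lemma hnorm_limit_space_tendsto:
  assumes a: "coherent a"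
  shows "(\<lambda>k. hnorm H (a k)) \<longlonglongrightarrow> hnorm (limit_space A) (code a)"
proof -
  have "(\<lambda>k. Re (ip H (a k) (a k))) \<longlonglongrightarrow> Re (lim_ip a a)"
    by (intro tendsto_intros lim_ip_tendsto a)
  then show ?thesis unfolding hnorm_def ip_limit_space[OF a a] by (rule tendsto_real_sqrt)
qed

lemma inner_product_space_limit_space: "inner_product_space (limit_space A)"
proof -
  let ?N = "limit_space A"
  have add: "ip ?N (f \<oplus>\<^bsub>?N\<^esub> g) h = ip ?N f h + ip ?N g h"
    if fgh: "f \<in> carrier ?N" "g \<in> carrier ?N" "h \<in> carrier ?N" for f g h
  proof -
    obtain a b c where f: "coherent a" "f = code a" and g: "coherent b" "g = code b"
      and h: "coherent c" "h = code c"
      using fgh by (meson limit_space_cases)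
    have "(\<lambda>k. ip H (a k) (c k) + ip H (b k) (c k)) \<longlonglongrightarrow> lim_ip a c + lim_ip b c"
      by (intro tendsto_add lim_ip_tendsto f g h)
    then have "lim_ip (\<lambda>k. a k \<oplus> b k) c = lim_ip a c + lim_ip b c"
      by (intro lim_ip_eqI) (simp add: coherent_carrier f g h)
    then show ?thesis by (simp add: f g h limit_space_add coherent_add)
  qed
  have smult: "ip ?N (z \<odot>\<^bsub>?N\<^esub> f) h = z * ip ?N f h"
    if fh: "f \<in> carrier ?N" "h \<in> carrier ?N" for z f h
  proof -
    obtain a c where f: "coherent a" "f = code a" and h: "coherent c" "h = code c"
      using fh by (meson limit_space_cases)
    have "(\<lambda>k. z * ip H (a k) (c k)) \<longlonglongrightarrow> z * lim_ip a c"
      by (intro tendsto_mult tendsto_const lim_ip_tendsto f h)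
    then have "lim_ip (\<lambda>k. z \<odot> a k) c = z * lim_ip a c"
      by (intro lim_ip_eqI) (simp add: coherent_carrier f h)
    then show ?thesis by (simp add: f h limit_space_smult coherent_smult)
  qed
  have commute: "ip ?N h f = cnj (ip ?N f h)"
    if fh: "f \<in> carrier ?N" "h \<in> carrier ?N" for f h
  proof -
    obtain a c where f: "coherent a" "f = code a" and h: "coherent c" "h = code c"
      using fh by (meson limit_space_cases)
    have "(\<lambda>k. ip H (c k) (a k)) \<longlonglongrightarrow> cnj (lim_ip a c)"
      unfolding ip_commute[OF coherent_carrier[OF f(1)] coherent_carrier[OF h(1)]]
      by (intro tendsto_cnj lim_ip_tendsto f h)
    then have "lim_ip c a = cnj (lim_ip a c)" by (rule lim_ip_eqI)
    then show ?thesis by (simp add: f h)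
  qed
  have nonneg: "0 \<le> Re (ip ?N f f)" if f: "f \<in> carrier ?N" for f
  proof -
    obtain a where f: "coherent a" "f = code a" using f by (rule limit_space_cases)
    have "(\<lambda>k. Re (ip H (a k) (a k))) \<longlonglongrightarrow> Re (lim_ip a a)"
      by (intro tendsto_intros lim_ip_tendsto f)
    then have "0 \<le> Re (lim_ip a a)" by (rule LIMSEQ_le_const) (simp add: coherent_carrier f)
    then show ?thesis by (simp add: f)
  qed
  have definite: "f = \<zero>\<^bsub>?N\<^esub>" if ff: "f \<in> carrier ?N" "ip ?N f f = 0" for f
  proof -
    obtain a where f: "coherent a" "f = code a" using ff(1) by (rule limit_space_cases)
    have "hnorm ?N (code a) = 0" unfolding hnorm_def using ff(2) f by simp
    then have lim: "(\<lambda>k. hnorm H (a k)) \<longlonglongrightarrow> 0" using hnorm_limit_space_tendsto[OF f(1)] by metis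
    \<comment> \<open>An increasing sequence of nonnegative numbers with limit 0 is constantly
      0.\<close>
    have "a k = \<zero>" for k
    proof -
      have "hnorm H (a k) \<le> 0" by (rule incseq_le[OF coherent_incseq[OF f(1)] lim])
      moreover have "0 \<le> hnorm H (a k)" using coherent_carrier[OF f(1)] by simp
      ultimately have "hnorm H (a k) = 0" by simp
      then show ?thesis using coherent_carrier[OF f(1)] hnorm_eq_0 by blast
    qed
    then have "a = (\<lambda>k. \<zero>)" by blast
    then show ?thesis unfolding f limit_space_zero by simp
  qed
  show ?thesis
    unfolding inner_product_space_def
    using module_limit_space add smult commute nonneg definite by blast
qed

abbreviation limit_hilbert :: "(nat \<Rightarrow> complex, 'n::finite) hilbert_module"
  where "limit_hilbert \<equiv> limit_space undefined"

lemma inner_product_limit_space: "inner_product (limit_space A)"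
  by unfold_locales (rule inner_product_space_limit_space)

text \<open>Subtraction is not a record field but is derived from the group inverse, hence the
  detour through the scalar \<open>-1\<close>.\<close>

lemma limit_space_minus:
  assumes a: "coherent a" and b: "coherent b"
  shows "code a \<ominus>\<^bsub>limit_space A\<^esub> code b = code (\<lambda>k. a k \<ominus> b k)"
proof -
  interpret N: inner_product "limit_space A" by (rule inner_product_limit_space)
  have "code a \<ominus>\<^bsub>limit_space A\<^esub> code b =
      code a \<oplus>\<^bsub>limit_space A\<^esub> (-1) \<odot>\<^bsub>limit_space A\<^esub> code b"
    by (rule N.vec_eqI) (use a b in auto)
  then show ?thesis
    using a b by (simp add: limit_space_add limit_space_smult coherent_smult minus_eq_add_smult coherent_carrier)
qed

text \<open>With the next lemma this makes the norm the supremum of the coordinate norms, so that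
  estimates in the limit space can be checked coordinatewise.\<close>

lemma hnorm_le_hnorm_limit_space:
  "coherent a \<Longrightarrow> hnorm H (a k) \<le> hnorm (limit_space A) (code a)"
  by (rule incseq_le[OF coherent_incseq hnorm_limit_space_tendsto])

lemma hnorm_limit_space_le:
  "\<lbrakk>coherent a; \<And>k. hnorm H (a k) \<le> B\<rbrakk> \<Longrightarrow> hnorm (limit_space A) (code a) \<le> B"
  by (rule LIMSEQ_le_const2[OF hnorm_limit_space_tendsto]) auto

text \<open>The coordinates of \<open>W^-k x\<close>: the projection of \<open>W^(m-k) x\<close> to
  \<open>H\<close> is a power of \<open>U\<close> applied to \<open>x\<close> for nonnegative
  exponents and a power of \<open>Us\<close> for negative ones.\<close>

definition emb :: "nat \<Rightarrow> 'a \<Rightarrow> nat \<Rightarrow> 'a"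
  where "emb k x m = (if k \<le> m then (U ^^ (m - k)) x else (Us ^^ (k - m)) x)"

lemma coherent_emb:
  assumes x: "x \<in> carrier H"
  shows "coherent (emb k x)"
proof (rule coherentI[where B = "hnorm H x"])
  have *: "hnorm H ((Us ^^ m) x) \<le> hnorm H x" for m
    using bounded_linear_opD(4)[OF bounded_linear_op_funpow[OF Us_op] x] by simp
  show "emb k x m \<in> carrier H" "hnorm H (emb k x m) \<le> hnorm H x" for m
    using x * by (auto simp: emb_def)
  show "Us (emb k x (Suc m)) = emb k x m" for m
  proof (cases "k \<le> m")
    case True
    then show ?thesis using x by (simp add: emb_def Suc_diff_le)
  next
    case False
    then have "k - m = Suc (k - Suc m)" by simp
    then show ?thesis using False by (cases "k = Suc m") (simp_all add: emb_def)
  qed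
qed

text \<open>The inner products are constant from index \<open>k\<close> on, since the power of
  \<open>U\<close> moves over to \<open>a\<close> and brings it back to coordinate \<open>k\<close>.
  Pairing with \<open>W^-k x\<close> thus reads off that coordinate.\<close>

lemma lim_ip_emb:
  assumes a: "coherent a" and x: "x \<in> carrier H"
  shows "lim_ip a (emb k x) = ip H (a k) x"
proof (rule lim_ip_eqI)
  have "ip H (a (m + k)) (emb k x (m + k)) = ip H (a k) x" for m
  proof -
    have "ip H (a (k + m)) ((U ^^ m) x) = ip H ((Us ^^ m) (a (k + m))) x"
      using coherent_carrier[OF a] x by (simp add: ip_Us_pow_left)
    then show ?thesis unfolding coherent_Us_pow[OF a] by (simp add: emb_def add.commute)
  qed
  then have "(\<lambda>m. ip H (a (m + k)) (emb k x (m + k))) \<longlonglongrightarrow> ip H (a k) x" by simp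
  then show "(\<lambda>m. ip H (a m) (emb k x m)) \<longlonglongrightarrow> ip H (a k) x" by (rule LIMSEQ_offset)
qed

lemma hnorm_emb [simp]:
  assumes x: "x \<in> carrier H"
  shows "hnorm (limit_space A) (code (emb k x)) = hnorm H x"
  using x coherent_emb[OF x, of k] by (simp add: hnorm_def lim_ip_emb) (simp add: emb_def)

lemma limit_space_emb_minus:
  assumes "x \<in> carrier H" "y \<in> carrier H"
  shows "code (emb k x) \<ominus>\<^bsub>limit_space A\<^esub> code (emb k y) = code (emb k (x \<ominus> y))"
proof -
  interpret N: inner_product "limit_space A" by (rule inner_product_limit_space)
  show ?thesis
  proof (rule N.vec_eqI_right)
    fix f assume "f \<in> carrier (limit_space A)"
    then obtain c where c: "coherent c" "f = code c" by (rule limit_space_cases)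
    then show "ip (limit_space A) f (code (emb k x) \<ominus>\<^bsub>limit_space A\<^esub> code (emb k y)) =
        ip (limit_space A) f (code (emb k (x \<ominus> y)))"
      using assms by (simp add: coherent_emb lim_ip_emb coherent_carrier)
  qed (use assms coherent_emb in auto)
qed

text \<open>\<open>code (emb k (a k))\<close> is the orthogonal projection of \<open>code a\<close>
  onto \<open>W^-k H\<close>. By Pythagoras the squared distance is the gap between the squared
  limit norm and that of the \<open>k\<close>-th coordinate.\<close>

lemma emb_tendsto:
  assumes a: "coherent a"
  shows "inner_product.tends (limit_space A) (\<lambda>k. code (emb k (a k))) (code a)"
proof -
  interpret N: inner_product "limit_space A" by (rule inner_product_limit_space)
  note ak [simp] = coherent_carrier[OF a] and e [simp] = coherent_emb[OF ak]
  let ?n = "hnorm (limit_space A) (code a)"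
  have "(hnorm (limit_space A) (code a \<ominus>\<^bsub>limit_space A\<^esub> code (emb k (a k))))\<^sup>2 =
      ?n\<^sup>2 - (hnorm H (a k))\<^sup>2" for k
    using a by (simp add: N.hnorm_minus_sq lim_ip_emb ip_self)
  then have eq: "hnorm (limit_space A) (code (emb k (a k)) \<ominus>\<^bsub>limit_space A\<^esub> code a) =
      sqrt (?n\<^sup>2 - (hnorm H (a k))\<^sup>2)" for k
    using a by (metis N.hnorm_ge_0 N.hnorm_minus_commute N.minus_carrier code_carrier e real_sqrt_unique)
  have "(\<lambda>k. sqrt (?n\<^sup>2 - (hnorm H (a k))\<^sup>2)) \<longlonglongrightarrow> sqrt (?n\<^sup>2 - ?n\<^sup>2)"
    by (intro tendsto_intros hnorm_limit_space_tendsto a)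
  then show ?thesis unfolding N.tends_def eq by simp
qed

text \<open>A Cauchy sequence is Cauchy in each coordinate, uniformly in the coordinate, and the
  coordinatewise limits form its limit. The vectors \<open>W^-k (d j)\<close> are a countable dense
  set by \<open>emb_tendsto\<close>.\<close>

lemma hilbert_space_limit_space: "hilbert_space (limit_space A)"
proof -
  let ?N = "limit_space A"
  interpret N: inner_product ?N by (rule inner_product_limit_space)
  show ?thesis
  proof (rule N.hilbert_spaceI[where C = "(\<lambda>(k, j). code (emb k (d j))) ` UNIV"])
    fix s :: "nat \<Rightarrow> nat \<Rightarrow> complex"
    assume s: "\<And>k. s k \<in> carrier ?N"
      and C: "\<And>e. 0 < e \<Longrightarrow> \<exists>K. \<forall>m\<ge>K. \<forall>n\<ge>K. hnorm ?N (s m \<ominus>\<^bsub>?N\<^esub> s n) < e"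
    have "\<exists>a. coherent a \<and> s n = code a" for n using s[of n] by (metis limit_space_cases)
    then obtain a where a: "\<And>n. coherent (a n)" and sa: "\<And>n. s n = code (a n)" by metis
    note ac [simp] = coherent_carrier[OF a]
    have diff: "s m \<ominus>\<^bsub>?N\<^esub> s n = code (\<lambda>k. a m k \<ominus> a n k)" for m n
      unfolding sa by (rule limit_space_minus[OF a a])
    have diff_le: "hnorm H (a m k \<ominus> a n k) \<le> hnorm ?N (s m \<ominus>\<^bsub>?N\<^esub> s n)" for m n k
      unfolding diff by (rule hnorm_le_hnorm_limit_space[OF coherent_minus[OF a a]])
    have "\<exists>l. l \<in> carrier H \<and> tends (\<lambda>n. a n k) l" for k
    proof (rule complete[of "\<lambda>n. a n k"])
      fix e :: real assume "0 < e"
      then obtain K where "\<And>m n. K \<le> m \<Longrightarrow> K \<le> n \<Longrightarrow> hnorm ?N (s m \<ominus>\<^bsub>?N\<^esub> s n) < e"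
        using C by blast
      then have "hnorm H (a m k \<ominus> a n k) < e" if "K \<le> m" "m \<le> n" for m n
        using that by (intro le_less_trans[OF diff_le]) auto
      then show "\<exists>K. \<forall>m\<ge>K. \<forall>n\<ge>m. hnorm H (a m k \<ominus> a n k) < e" by blast
    qed auto
    then obtain l where lc [simp]: "\<And>k. l k \<in> carrier H" and l: "\<And>k. tends (\<lambda>n. a n k) (l k)"
      by metis
    \<comment> \<open>One fixed tolerance bounds the tail of \<open>s\<close>, and so all
      coordinates of \<open>l\<close>; it is the \<open>+ 1\<close> in the bound below.\<close>
    obtain K where K: "\<And>n. K \<le> n \<Longrightarrow> hnorm ?N (s K \<ominus>\<^bsub>?N\<^esub> s n) < 1"
      using C[of 1] by auto
    have coh: "coherent l"
    proof (rule coherentI[where B = "hnorm ?N (s K) + 1"])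
      show "Us (l (Suc k)) = l k" for k
      proof (rule tends_unique)
        show "tends (\<lambda>n. a n k) (Us (l (Suc k)))"
          using bounded_linear_op_tends[OF Us_op _ _ l[of "Suc k"]] coherent_Us[OF a] by simp
      qed (use l in auto)
      show "hnorm H (l k) \<le> hnorm ?N (s K) + 1" for k
      proof -
        have "hnorm H (a n k) \<le> hnorm ?N (s K) + 1" if "K \<le> n" for n
        proof -
          have "hnorm H (a n k) \<le> hnorm ?N (s n)"
            unfolding sa by (rule hnorm_le_hnorm_limit_space[OF a])
          then show ?thesis using N.hnorm_diff_le[OF s[of K] s[of n]] K[OF that] by linarith
        qed
        moreover have "(\<lambda>n. hnorm H (a n k)) \<longlonglongrightarrow> hnorm H (l k)"
          by (rule tends_hnorm) (use l in auto)
        ultimately show ?thesis by (intro LIMSEQ_le_const2) blast+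
      qed
    qed simp
    have "N.tends s (code l)"
      unfolding N.tends_def
    proof (rule LIMSEQ_I)
      fix r :: real assume "0 < r"
      then obtain K where K: "\<And>m n. K \<le> m \<Longrightarrow> K \<le> n \<Longrightarrow> hnorm ?N (s m \<ominus>\<^bsub>?N\<^esub> s n) < r / 2"
        using C[of "r / 2"] by (meson half_gt_zero)
      have "norm (hnorm ?N (s m \<ominus>\<^bsub>?N\<^esub> code l) - 0) < r" if m: "K \<le> m" for m
      proof -
        \<comment> \<open>Only the weak inequality survives the limit over \<open>n\<close>; half of
          \<open>r\<close> leaves room for the strict one.\<close>
        have "hnorm ?N (code (\<lambda>k. a m k \<ominus> l k)) \<le> r / 2"
        proof (rule hnorm_limit_space_le[OF coherent_minus[OF a coh]])
          fix k
          have "tends (\<lambda>n. a m k \<ominus> a n k) (a m k \<ominus> l k)"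
          proof -
            have "(a m k \<ominus> a n k) \<ominus> (a m k \<ominus> l k) = l k \<ominus> a n k" for n
              by (rule vec_eqI) auto
            then show ?thesis using l[of k] unfolding tends_def by (simp add: hnorm_minus_commute)
          qed
          then have "(\<lambda>n. hnorm H (a m k \<ominus> a n k)) \<longlonglongrightarrow> hnorm H (a m k \<ominus> l k)"
            by (intro tends_hnorm) auto
          moreover have "hnorm H (a m k \<ominus> a n k) \<le> r / 2" if "K \<le> n" for n
            using diff_le[of m k n] K[OF m that] by linarith
          ultimately show "hnorm H (a m k \<ominus> l k) \<le> r / 2"
            by (intro LIMSEQ_le_const2) blast+
        qed
        then show ?thesis
          using \<open>0 < r\<close> N.hnorm_ge_0[OF code_carrier[OF coherent_minus[OF a coh, of m]]]
          unfolding sa limit_space_minus[OF a coh] by simp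
      qed
      then show "\<exists>K. \<forall>m\<ge>K. norm (hnorm ?N (s m \<ominus>\<^bsub>?N\<^esub> code l) - 0) < r" by blast
    qed
    then show "\<exists>l\<in>carrier ?N. N.tends s l" using coh by blast
  next
    show "(\<lambda>(k, j). code (emb k (d j))) ` UNIV \<subseteq> carrier ?N" using coherent_emb by auto
    fix f and e :: real assume f: "f \<in> carrier ?N" and e: "0 < e"
    obtain a where a: "coherent a" "f = code a" using f by (rule limit_space_cases)
    note ac [simp] = coherent_carrier[OF a(1)]
    have "(\<lambda>k. hnorm ?N (code (emb k (a k)) \<ominus>\<^bsub>?N\<^esub> f)) \<longlonglongrightarrow> 0"
      unfolding a(2) N.tends_def[symmetric] by (rule emb_tendsto[OF a(1)])
    then obtain k where k: "hnorm ?N (code (emb k (a k)) \<ominus>\<^bsub>?N\<^esub> f) < e / 2"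
      using order_tendstoD(2)[of _ 0 sequentially "e / 2"] e eventually_happens by fastforce
    obtain j where j: "hnorm H (a k \<ominus> d j) < e / 2" using d_dense[OF ac] e by (meson half_gt_zero)
    have "hnorm ?N (f \<ominus>\<^bsub>?N\<^esub> code (emb k (d j))) \<le>
        hnorm ?N (f \<ominus>\<^bsub>?N\<^esub> code (emb k (a k))) +
        hnorm ?N (code (emb k (a k)) \<ominus>\<^bsub>?N\<^esub> code (emb k (d j)))"
      using f coherent_emb by (intro N.hnorm_triangle_minus) auto
    also have "\<dots> < e"
      using k j f coherent_emb[OF ac] by (simp add: limit_space_emb_minus N.hnorm_minus_commute[of f])
    finally show "\<exists>y\<in>(\<lambda>(k, j). code (emb k (d j))) ` UNIV. hnorm ?N (f \<ominus>\<^bsub>?N\<^esub> y) < e"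
      by auto
  qed simp
qed

lemma hilbert_limit_space: "hilbert (limit_space A)"
  by (intro hilbert.intro hilbert_axioms.intro inner_product_limit_space hilbert_space_limit_space)

end

section \<open>Extending the module action\<close>

locale contractive_module =
  fixes \<Omega> :: "(complex ^ 'n::finite) set" and R :: "('a, 'n) hilbert_module" (structure)
  assumes module_over: "hilbert_module_over \<Omega> R" and bounded: "bounded \<Omega>" and nonempty: "\<Omega> \<noteq> {}"
begin

sublocale hilbert R
  using module_over
  by (auto simp: hilbert_module_over_def hilbert_space_def hilbert_def inner_product_def hilbert_axioms_def)

lemma A_module_R: "Module.module (A_alg \<Omega>) (A_module R)"
  using module_over by (simp add: hilbert_module_over_def)

text \<open>A point of \<Omega> supplies a nonnegative value, and boundedness on \<Omega> puts it
  below the supremum.\<close>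

lemma A_norm_nonneg: "\<phi> \<in> A_carrier \<Omega> \<Longrightarrow> 0 \<le> A_norm \<Omega> \<phi>"
  using nonempty cSUP_upper2[OF A_norm_bdd_above[OF bounded]] unfolding A_norm_def
  by (metis equals0I norm_ge_zero)

lemma act_carrier [simp, intro]:
  "\<lbrakk>\<phi> \<in> A_carrier \<Omega>; x \<in> carrier R\<rbrakk> \<Longrightarrow> act R \<phi> x \<in> carrier R"
  using module.smult_closed[OF A_module_R, of \<phi> x] by (simp add: A_alg_def A_module_def)

lemma act_add:
  "\<lbrakk>\<phi> \<in> A_carrier \<Omega>; x \<in> carrier R; y \<in> carrier R\<rbrakk> \<Longrightarrow> act R \<phi> (x \<oplus> y) = act R \<phi> x \<oplus> act R \<phi> y"
  using module.smult_r_distr[OF A_module_R, of \<phi> x y] by (simp add: A_alg_def A_module_def)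

lemma act_plus:
  "\<lbrakk>\<phi> \<in> A_carrier \<Omega>; \<psi> \<in> A_carrier \<Omega>; x \<in> carrier R\<rbrakk>
    \<Longrightarrow> act R (\<lambda>z. \<phi> z + \<psi> z) x = act R \<phi> x \<oplus> act R \<psi> x"
  using module.smult_l_distr[OF A_module_R, of \<phi> \<psi> x] by (simp add: A_alg_def A_module_def)

lemma act_mult:
  "\<lbrakk>\<phi> \<in> A_carrier \<Omega>; \<psi> \<in> A_carrier \<Omega>; x \<in> carrier R\<rbrakk>
    \<Longrightarrow> act R (\<lambda>z. \<phi> z * \<psi> z) x = act R \<phi> (act R \<psi> x)"
  using module.smult_assoc1[OF A_module_R, of \<phi> \<psi> x] by (simp add: A_alg_def A_module_def)

lemma act_one: "x \<in> carrier R \<Longrightarrow> act R (\<lambda>z. if z \<in> \<Omega> then 1 else 0) x = x"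
  using module.smult_one[OF A_module_R, of x] by (simp add: A_alg_def A_module_def)

lemma act_scale:
  "\<lbrakk>\<phi> \<in> A_carrier \<Omega>; x \<in> carrier R\<rbrakk> \<Longrightarrow> act R (\<lambda>z. c * \<phi> z) x = c \<odot> act R \<phi> x"
  using module_over by (simp add: hilbert_module_over_def)

lemma A_carrier_scale:
  assumes "\<phi> \<in> A_carrier \<Omega>"
  shows "(\<lambda>z. c * \<phi> z) \<in> A_carrier \<Omega>"
proof -
  \<comment> \<open>Constants belong to the algebra only when cut off outside \<Omega>; since \<phi>
    vanishes there, the product is the same.\<close>
  have "(\<lambda>z. c * \<phi> z) = (\<lambda>z. (if z \<in> \<Omega> then c else 0) * \<phi> z)"
    using assms by (auto simp: fun_eq_iff A_carrier_def)
  then show ?thesis using A_carrier_mult[OF bounded A_carrier_const assms] by simp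
qed

lemma act_const: "x \<in> carrier R \<Longrightarrow> act R (\<lambda>z. if z \<in> \<Omega> then c else 0) x = c \<odot> x"
proof -
  assume x: "x \<in> carrier R"
  have "(\<lambda>z. if z \<in> \<Omega> then c else 0) = (\<lambda>z. c * (if z \<in> \<Omega> then 1 else 0))" by auto
  then show ?thesis using act_scale[OF A_carrier_const x] act_one[OF x] by simp
qed

text \<open>Scalars act as constant functions, and these commute with \<phi> in the algebra.\<close>

lemma act_smult:
  assumes "\<phi> \<in> A_carrier \<Omega>" "x \<in> carrier R"
  shows "act R \<phi> (c \<odot> x) = c \<odot> act R \<phi> x"
proof -
  have "(\<lambda>z. \<phi> z * (if z \<in> \<Omega> then c else 0)) = (\<lambda>z. c * \<phi> z)"
    using assms by (auto simp: fun_eq_iff A_carrier_def)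
  then show ?thesis
    using act_mult[OF assms(1) A_carrier_const assms(2), of c] assms by (simp add: act_const act_scale)
qed

lemma act_op: "\<phi> \<in> A_carrier \<Omega> \<Longrightarrow> bounded_linear_op (A_norm \<Omega> \<phi>) (act R \<phi>)"
  using module_over unfolding bounded_linear_op_def
  by (auto simp: act_add act_smult hilbert_module_over_def)

abbreviation "acts \<phi> \<equiv> adj R (act R \<phi>)"

lemmas acts_op = bounded_linear_op_adj[OF act_op A_norm_nonneg]

lemma acts_carrier [simp, intro]:
  "\<lbrakk>\<phi> \<in> A_carrier \<Omega>; x \<in> carrier R\<rbrakk> \<Longrightarrow> acts \<phi> x \<in> carrier R"
  by (rule adj_carrier[OF act_op A_norm_nonneg])

lemma ip_acts:
  assumes "\<phi> \<in> A_carrier \<Omega>" "x \<in> carrier R" "y \<in> carrier R"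
  shows "ip R x (acts \<phi> y) = ip R (act R \<phi> x) y" "ip R (acts \<phi> y) x = ip R y (act R \<phi> x)"
  using assms ip_adj[OF act_op A_norm_nonneg] ip_adj_left[OF act_op A_norm_nonneg] by auto

lemma acts_plus:
  "\<lbrakk>\<phi> \<in> A_carrier \<Omega>; \<psi> \<in> A_carrier \<Omega>; x \<in> carrier R\<rbrakk>
    \<Longrightarrow> acts (\<lambda>z. \<phi> z + \<psi> z) x = acts \<phi> x \<oplus> acts \<psi> x"
  by (rule vec_eqI) (simp_all add: ip_acts A_carrier_add act_plus)

lemma acts_mult:
  "\<lbrakk>\<phi> \<in> A_carrier \<Omega>; \<psi> \<in> A_carrier \<Omega>; x \<in> carrier R\<rbrakk>
    \<Longrightarrow> acts (\<lambda>z. \<phi> z * \<psi> z) x = acts \<psi> (acts \<phi> x)"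
  by (rule vec_eqI) (simp_all add: ip_acts A_carrier_mult[OF bounded] act_mult)

lemma acts_one: "x \<in> carrier R \<Longrightarrow> acts (\<lambda>z. if z \<in> \<Omega> then 1 else 0) x = x"
  by (rule vec_eqI) (simp_all add: ip_acts A_carrier_const act_one)

lemma acts_scale:
  "\<lbrakk>\<phi> \<in> A_carrier \<Omega>; x \<in> carrier R\<rbrakk> \<Longrightarrow> acts (\<lambda>z. c * \<phi> z) x = cnj c \<odot> acts \<phi> x"
  by (rule vec_eqI) (simp_all add: ip_acts A_carrier_scale act_scale)

end

section \<open>The extended operators and the module they form\<close>

locale module_isometry = contractive_module \<Omega> R + dense_isometry R U d
  for \<Omega> :: "(complex ^ 'n::finite) set" and R :: "('a, 'n) hilbert_module" (structure) and U d +
  assumes U_act: "\<lbrakk>\<phi> \<in> A_carrier \<Omega>; x \<in> carrier R\<rbrakk> \<Longrightarrow> U (act R \<phi> x) = act R \<phi> (U x)"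
begin

lemma U_pow_act:
  "\<lbrakk>\<phi> \<in> A_carrier \<Omega>; x \<in> carrier R\<rbrakk> \<Longrightarrow> (U ^^ k) (act R \<phi> x) = act R \<phi> ((U ^^ k) x)"
  by (induction k) (auto simp: U_act)

lemma Us_acts: "\<lbrakk>\<phi> \<in> A_carrier \<Omega>; x \<in> carrier R\<rbrakk> \<Longrightarrow> Us (acts \<phi> x) = acts \<phi> (Us x)"
  by (rule vec_eqI) (simp_all add: ip_acts ip_Us U_act)

text \<open>Coherence survives because the adjoint of \<open>act R \<phi>\<close> commutes with
  \<open>Us\<close>. The operator \<open>act R \<phi>\<close> commutes with \<open>U\<close>, but in
  general not with \<open>Us\<close>.\<close>

lemma coherent_acts:
  assumes \<phi>: "\<phi> \<in> A_carrier \<Omega>" and a: "coherent a"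
  shows "coherent (\<lambda>k. acts \<phi> (a k))"
proof -
  note [simp] = coherent_carrier[OF a]
  obtain B where B: "\<And>k. hnorm R (a k) \<le> B" using a unfolding coherent_def by blast
  show ?thesis
  proof (rule coherentI[where B = "A_norm \<Omega> \<phi> * B"])
    show "hnorm R (acts \<phi> (a k)) \<le> A_norm \<Omega> \<phi> * B" for k
    proof -
      have "hnorm R (acts \<phi> (a k)) \<le> A_norm \<Omega> \<phi> * hnorm R (a k)"
        by (rule bounded_linear_opD(4)[OF acts_op[OF \<phi> \<phi>]]) simp
      also have "\<dots> \<le> A_norm \<Omega> \<phi> * B" by (rule mult_left_mono[OF B A_norm_nonneg[OF \<phi>]])
      finally show ?thesis .
    qed
  qed (use \<phi> in \<open>simp_all add: Us_acts coherent_Us[OF a]\<close>)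
qed

text \<open>Of the extended operator and its adjoint it is the adjoint that acts coordinatewise on coherent
  sequences.\<close>

definition ext_adj :: "((complex ^ 'n) \<Rightarrow> complex) \<Rightarrow> (nat \<Rightarrow> complex) \<Rightarrow> nat \<Rightarrow> complex"
  where "ext_adj \<phi> f = code (\<lambda>k. acts \<phi> (decode f k))"

text \<open>The adjoint is taken in a copy of the space with an arbitrary action, since
  \<open>N\<close> itself contains \<open>ext_act\<close>. As \<open>adj\<close> reads only carrier
  and inner product, it is also the adjoint in \<open>N\<close>.\<close>

definition ext_act :: "((complex ^ 'n) \<Rightarrow> complex) \<Rightarrow> (nat \<Rightarrow> complex) \<Rightarrow> nat \<Rightarrow> complex"
  where "ext_act \<phi> = adj (limit_hilbert :: (nat \<Rightarrow> complex, 'n) hilbert_module) (ext_adj \<phi>)"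

abbreviation "N \<equiv> limit_space ext_act"

sublocale N: hilbert N
  by (rule hilbert_limit_space)

lemma act_N [simp]: "act N = ext_act"
  by (simp add: limit_space_def)

lemma ext_act_eq: "ext_act \<phi> = adj N (ext_adj \<phi>)"
  by (simp add: ext_act_def adj_def limit_space_def fun_eq_iff)

lemma ext_adj_code: "coherent a \<Longrightarrow> ext_adj \<phi> (code a) = code (\<lambda>k. acts \<phi> (a k))"
  by (simp add: ext_adj_def)

lemma ext_adj_op:
  assumes \<phi>: "\<phi> \<in> A_carrier \<Omega>"
  shows "N.bounded_linear_op (A_norm \<Omega> \<phi>) (ext_adj \<phi>)"
  unfolding N.bounded_linear_op_def
proof (intro conjI ballI allI Pi_I)
  note acts = bounded_linear_opD[OF acts_op[OF \<phi> \<phi>]]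
  fix f assume "f \<in> carrier N"
  then obtain a where f: "coherent a" "f = code a" by (rule limit_space_cases)
  note [simp] = ext_adj_code coherent_acts[OF \<phi>] coherent_carrier[OF f(1)] f(1)
  show "ext_adj \<phi> f \<in> carrier N" by (simp add: f(2))
  show "ext_adj \<phi> (c \<odot>\<^bsub>N\<^esub> f) = c \<odot>\<^bsub>N\<^esub> ext_adj \<phi> f" for c
    by (simp add: f(2) limit_space_smult coherent_smult acts)
  show "ext_adj \<phi> (f \<oplus>\<^bsub>N\<^esub> g) = ext_adj \<phi> f \<oplus>\<^bsub>N\<^esub> ext_adj \<phi> g" if g: "g \<in> carrier N" for g
  proof -
    obtain b where g: "coherent b" "g = code b" using g by (rule limit_space_cases)
    then show ?thesis
      using coherent_carrier[OF g(1)] by (simp add: f(2) limit_space_add coherent_add acts)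
  qed
  show "hnorm N (ext_adj \<phi> f) \<le> A_norm \<Omega> \<phi> * hnorm N f"
    unfolding f(2) ext_adj_code[OF f(1)]
  proof (rule hnorm_limit_space_le[OF coherent_acts[OF \<phi> f(1)]])
    fix k
    have "hnorm R (acts \<phi> (a k)) \<le> A_norm \<Omega> \<phi> * hnorm R (a k)" by (rule acts) simp
    also have "\<dots> \<le> A_norm \<Omega> \<phi> * hnorm N (code a)"
      by (intro mult_left_mono hnorm_le_hnorm_limit_space A_norm_nonneg \<phi> f)
    finally show "hnorm R (acts \<phi> (a k)) \<le> A_norm \<Omega> \<phi> * hnorm N (code a)" .
  qed
qed

lemma ext_adj_carrier [simp, intro]:
  "\<lbrakk>\<phi> \<in> A_carrier \<Omega>; f \<in> carrier N\<rbrakk> \<Longrightarrow> ext_adj \<phi> f \<in> carrier N"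
  by (rule N.bounded_linear_opD(1)[OF ext_adj_op])

lemma ext_act_op: "\<phi> \<in> A_carrier \<Omega> \<Longrightarrow> N.bounded_linear_op (A_norm \<Omega> \<phi>) (ext_act \<phi>)"
  using N.bounded_linear_op_adj[OF ext_adj_op A_norm_nonneg] by (simp only: ext_act_eq[symmetric])

lemma ext_act_carrier [simp, intro]:
  "\<lbrakk>\<phi> \<in> A_carrier \<Omega>; f \<in> carrier N\<rbrakk> \<Longrightarrow> ext_act \<phi> f \<in> carrier N"
  by (rule N.bounded_linear_opD(1)[OF ext_act_op])

lemma ip_ext_act:
  assumes "\<phi> \<in> A_carrier \<Omega>" "f \<in> carrier N" "g \<in> carrier N"
  shows "ip N g (ext_act \<phi> f) = ip N (ext_adj \<phi> g) f" "ip N (ext_act \<phi> f) g = ip N f (ext_adj \<phi> g)"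
  using assms N.ip_adj[OF ext_adj_op A_norm_nonneg, folded ext_act_eq]
    N.ip_adj_left[OF ext_adj_op A_norm_nonneg, folded ext_act_eq] by auto

lemma adj_ext_act:
  "\<lbrakk>\<phi> \<in> A_carrier \<Omega>; f \<in> carrier N\<rbrakk> \<Longrightarrow> adj N (ext_act \<phi>) f = ext_adj \<phi> f"
  by (rule N.adj_eqI) (auto simp: ip_ext_act)

lemma ext_adj_plus:
  assumes "\<phi> \<in> A_carrier \<Omega>" "\<psi> \<in> A_carrier \<Omega>" "f \<in> carrier N"
  shows "ext_adj (\<lambda>z. \<phi> z + \<psi> z) f = ext_adj \<phi> f \<oplus>\<^bsub>N\<^esub> ext_adj \<psi> f"
  using assms(3)
  by (rule limit_space_cases)
    (simp add: ext_adj_code limit_space_add coherent_acts assms(1,2) acts_plus coherent_carrier)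

lemma ext_adj_mult:
  assumes "\<phi> \<in> A_carrier \<Omega>" "\<psi> \<in> A_carrier \<Omega>" "f \<in> carrier N"
  shows "ext_adj (\<lambda>z. \<phi> z * \<psi> z) f = ext_adj \<psi> (ext_adj \<phi> f)"
  using assms(3)
  by (rule limit_space_cases) (simp add: ext_adj_code coherent_acts assms(1,2) acts_mult coherent_carrier)

lemma ext_adj_one: "f \<in> carrier N \<Longrightarrow> ext_adj (\<lambda>z. if z \<in> \<Omega> then 1 else 0) f = f"
  by (erule limit_space_cases) (simp add: ext_adj_code acts_one coherent_carrier)

lemma ext_adj_scale:
  assumes "\<phi> \<in> A_carrier \<Omega>" "f \<in> carrier N"
  shows "ext_adj (\<lambda>z. c * \<phi> z) f = cnj c \<odot>\<^bsub>N\<^esub> ext_adj \<phi> f"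
  using assms(2)
  by (rule limit_space_cases)
    (simp add: ext_adj_code limit_space_smult coherent_acts assms(1) acts_scale coherent_carrier)

text \<open>The laws that vary the algebra element are dual to identities for
  \<open>ext_adj\<close>, hence the tests with \<open>N.vec_eqI_right\<close>.\<close>

lemma A_module_N: "Module.module (A_alg \<Omega>) (A_module N)"
proof (rule moduleI[OF cring_A_alg[OF bounded]])
  have N: "abelian_group N" by (rule N.vs.M.abelian_group_axioms)
  show "abelian_group (A_module N)"
  proof (rule abelian_groupI)
    show "\<exists>g\<in>carrier (A_module N). g \<oplus>\<^bsub>A_module N\<^esub> f = \<zero>\<^bsub>A_module N\<^esub>"
      if "f \<in> carrier (A_module N)" for f
      using that N.vs.M.l_neg[of f] N.vs.M.a_inv_closed[of f] by (auto simp: A_module_def)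
  qed (auto simp: A_module_def N.vs.M.a_ac)
  fix \<phi> \<psi> f
  assume "\<phi> \<in> carrier (A_alg \<Omega>)" "\<psi> \<in> carrier (A_alg \<Omega>)" "f \<in> carrier (A_module N)"
  then have \<phi>: "\<phi> \<in> A_carrier \<Omega>" and \<psi>: "\<psi> \<in> A_carrier \<Omega>" and f: "f \<in> carrier N"
    by (auto simp: A_alg_def A_module_def)
  have "ext_act (\<lambda>z. \<phi> z + \<psi> z) f = ext_act \<phi> f \<oplus>\<^bsub>N\<^esub> ext_act \<psi> f"
    using \<phi> \<psi> f by (intro N.vec_eqI_right) (auto simp: ip_ext_act A_carrier_add ext_adj_plus)
  then show "(\<phi> \<oplus>\<^bsub>A_alg \<Omega>\<^esub> \<psi>) \<odot>\<^bsub>A_module N\<^esub> f =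
      \<phi> \<odot>\<^bsub>A_module N\<^esub> f \<oplus>\<^bsub>A_module N\<^esub> \<psi> \<odot>\<^bsub>A_module N\<^esub> f"
    by (simp add: A_alg_def A_module_def)
  have "ext_act (\<lambda>z. \<phi> z * \<psi> z) f = ext_act \<phi> (ext_act \<psi> f)"
    using \<phi> \<psi> f
    by (intro N.vec_eqI_right) (auto simp: ip_ext_act A_carrier_mult[OF bounded] ext_adj_mult)
  then show "(\<phi> \<otimes>\<^bsub>A_alg \<Omega>\<^esub> \<psi>) \<odot>\<^bsub>A_module N\<^esub> f =
      \<phi> \<odot>\<^bsub>A_module N\<^esub> (\<psi> \<odot>\<^bsub>A_module N\<^esub> f)"
    by (simp add: A_alg_def A_module_def)
next
  fix f assume "f \<in> carrier (A_module N)"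
  then have f: "f \<in> carrier N" by (simp add: A_module_def)
  have "ext_act (\<lambda>z. if z \<in> \<Omega> then 1 else 0) f = f"
    using f by (intro N.vec_eqI_right) (auto simp: ip_ext_act A_carrier_const ext_adj_one)
  then show "\<one>\<^bsub>A_alg \<Omega>\<^esub> \<odot>\<^bsub>A_module N\<^esub> f = f"
    by (simp add: A_alg_def A_module_def)
qed (auto simp: A_alg_def A_module_def N.bounded_linear_opD(2)[OF ext_act_op])

lemma hilbert_module_over_N: "hilbert_module_over \<Omega> N"
  unfolding hilbert_module_over_def
proof (intro conjI ballI allI)
  fix c \<phi> f assume \<phi>: "\<phi> \<in> A_carrier \<Omega>" and f: "f \<in> carrier N"
  have "ext_act (\<lambda>z. c * \<phi> z) f = c \<odot>\<^bsub>N\<^esub> ext_act \<phi> f"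
    using \<phi> f by (intro N.vec_eqI_right) (auto simp: ip_ext_act A_carrier_scale ext_adj_scale)
  then show "act N (\<lambda>z. c * \<phi> z) f = c \<odot>\<^bsub>N\<^esub> act N \<phi> f" by simp
next
  fix \<phi> f assume "\<phi> \<in> A_carrier \<Omega>" "f \<in> carrier N"
  then show "hnorm N (act N \<phi> f) \<le> A_norm \<Omega> \<phi> * hnorm N f"
    using N.bounded_linear_opD(4)[OF ext_act_op] by simp
qed (rule hilbert_space_limit_space A_module_N)+

text \<open>Pairing with \<open>W^-k x\<close> reads off coordinate \<open>k\<close>, where
  \<open>ext_adj\<close> acts as the adjoint of \<open>act R \<phi>\<close>. So
  \<open>ext_act \<phi>\<close> leaves every \<open>W^-k R\<close> invariant, and for
  \<open>k = 0\<close> it extends the given action.\<close>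

lemma ext_act_emb:
  assumes \<phi>: "\<phi> \<in> A_carrier \<Omega>" and x: "x \<in> carrier R"
  shows "ext_act \<phi> (code (emb k x)) = code (emb k (act R \<phi> x))"
proof (rule N.vec_eqI_right)
  fix g assume g: "g \<in> carrier N"
  then obtain b where b: "coherent b" "g = code b" by (rule limit_space_cases)
  then show "ip N g (ext_act \<phi> (code (emb k x))) = ip N g (code (emb k (act R \<phi> x)))"
    using \<phi> x g
    by (simp add: ip_ext_act coherent_emb ext_adj_code coherent_acts lim_ip_emb ip_acts coherent_carrier)
qed (use \<phi> x coherent_emb in auto)

lemma embeds_N: "embeds_as_submodule \<Omega> R N"
proof -
  let ?J = "\<lambda>x. code (emb 0 x)"
  have J [simp]: "x \<in> carrier R \<Longrightarrow> ?J x \<in> carrier N" for x using coherent_emb by blast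
  have J_add: "?J (x \<oplus> y) = ?J x \<oplus>\<^bsub>N\<^esub> ?J y" if "x \<in> carrier R" "y \<in> carrier R" for x y
  proof -
    have "emb 0 (x \<oplus> y) = (\<lambda>k. emb 0 x k \<oplus> emb 0 y k)"
      using that bounded_linear_opD(2)[OF bounded_linear_op_funpow[OF U_op]]
      by (simp add: emb_def fun_eq_iff)
    then show ?thesis using that by (simp add: limit_space_add coherent_emb)
  qed
  have iso: "isometric_module_map \<Omega> R N ?J"
    unfolding isometric_module_map_def by (simp add: J_add ext_act_emb)
  moreover have "submodule (?J ` carrier R) (A_alg \<Omega>) (A_module N)"
  proof (rule module.submoduleI[OF A_module_N])
    have zero: "\<zero>\<^bsub>N\<^esub> = ?J \<zero>"
      using hnorm_emb[OF zero_carrier, of ext_act 0] N.hnorm_eq_0[OF J[OF zero_carrier]] by simp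
    then show "\<zero>\<^bsub>A_module N\<^esub> \<in> ?J ` carrier R"
      using zero_carrier by (simp add: A_module_def)
    fix f assume "f \<in> ?J ` carrier R"
    then obtain x where x: "x \<in> carrier R" "f = ?J x" by blast
    have "\<ominus>\<^bsub>A_module N\<^esub> f = ?J (\<ominus> x)"
    proof (rule abelian_group.minus_equality)
      show "abelian_group (A_module N)" using A_module_N by (rule module.axioms(2))
      show "?J (\<ominus> x) \<oplus>\<^bsub>A_module N\<^esub> f = \<zero>\<^bsub>A_module N\<^esub>"
        using x J_add[of "\<ominus> x" x] by (simp add: A_module_def zero vs.M.l_neg)
    qed (use x in \<open>auto simp: A_module_def\<close>)
    then show "\<ominus>\<^bsub>A_module N\<^esub> f \<in> ?J ` carrier R" using x by blast
    show "f \<oplus>\<^bsub>A_module N\<^esub> g \<in> ?J ` carrier R" if g: "g \<in> ?J ` carrier R" for g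
    proof -
      obtain y where y: "y \<in> carrier R" "g = ?J y" using g by blast
      then have "f \<oplus>\<^bsub>A_module N\<^esub> g = ?J (x \<oplus> y)" using x by (simp add: A_module_def J_add)
      then show ?thesis using x y by blast
    qed
    show "\<phi> \<odot>\<^bsub>A_module N\<^esub> f \<in> ?J ` carrier R" if "\<phi> \<in> carrier (A_alg \<Omega>)" for \<phi>
      using that x ext_act_emb by (auto simp: A_module_def A_alg_def)
  qed (auto simp: A_module_def)
  moreover have "closedin (htopology N) (?J ` carrier R)"
    unfolding htopology_def N.metric.metric_closedin_iff_sequentially_closed
  proof (intro conjI allI impI)
    fix s l assume *: "range s \<subseteq> ?J ` carrier R \<and> limitin N.metric.mtopology s l sequentially"
    then have "\<exists>x. x \<in> carrier R \<and> s n = ?J x" for n by blast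
    then obtain x where x: "\<And>n. x n \<in> carrier R" and s: "\<And>n. s n = ?J (x n)" by metis
    have sN: "s n \<in> carrier N" for n using s x by simp
    have l: "l \<in> carrier N" using * N.metric.limitin_mspace by blast
    then have lim: "N.tends s l" using * N.limitin_iff_tends[OF sN] by (simp add: htopology_def)
    \<comment> \<open>The isometry turns the convergent sequence of images into a Cauchy sequence in
      \<open>R\<close>; completeness of \<open>R\<close> makes the image closed.\<close>
    obtain y where y: "y \<in> carrier R" "tends x y"
    proof (rule complete[OF x])
      fix e :: real assume e: "0 < e"
      then have "\<forall>\<^sub>F n in sequentially. hnorm N (s n \<ominus>\<^bsub>N\<^esub> l) < e / 2"
        using lim unfolding N.tends_def by (intro order_tendstoD(2)) auto
      then obtain K where K: "\<And>n. K \<le> n \<Longrightarrow> hnorm N (s n \<ominus>\<^bsub>N\<^esub> l) < e / 2"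
        unfolding eventually_sequentially by blast
      have "hnorm R (x m \<ominus> x n) < e" if "K \<le> m" "m \<le> n" for m n
      proof -
        have "hnorm R (x m \<ominus> x n) = hnorm N (s m \<ominus>\<^bsub>N\<^esub> s n)"
          using x by (simp add: s limit_space_emb_minus)
        also have "\<dots> \<le> hnorm N (s m \<ominus>\<^bsub>N\<^esub> l) + hnorm N (l \<ominus>\<^bsub>N\<^esub> s n)"
          by (rule N.hnorm_triangle_minus[OF sN l sN])
        also have "\<dots> < e"
          using K[of m] K[of n] that N.hnorm_minus_commute[OF l sN, of n] by simp
        finally show ?thesis .
      qed
      then show "\<exists>K. \<forall>m\<ge>K. \<forall>n\<ge>m. hnorm R (x m \<ominus> x n) < e" by blast
    qed
    have "N.tends s (?J y)"
      using y x unfolding N.tends_def tends_def s by (simp add: limit_space_emb_minus)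
    then have "l = ?J y" using N.tends_unique[OF sN l _ lim] y by simp
    then show "l \<in> ?J ` carrier R" using y by blast
  qed (use J in blast)
  ultimately show ?thesis unfolding embeds_as_submodule_def by blast
qed

end

section \<open>Normality of the extended operators\<close>

locale pure_essentially_reductive = module_isometry \<Omega> R U d
  for \<Omega> :: "(complex ^ 'n::finite) set" and R :: "('a, 'n) hilbert_module" (structure) and U d +
  assumes ess: "\<phi> \<in> A_carrier \<Omega> \<Longrightarrow> essentially_normal_op R (act R \<phi>)"
    and pure: "(\<Inter>k::nat. (U ^^ k) ` carrier R) = {\<zero>}"
begin

text \<open>\<open>compact_op\<close> speaks of the unit ball, so the limit is first found for
  vectors of norm at most 1 and then transferred by homogeneity.\<close>

lemma hnorm_acts_U_pow:
  assumes \<phi>: "\<phi> \<in> A_carrier \<Omega>" and x: "x \<in> carrier R"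
  shows "(\<lambda>k. hnorm R (acts \<phi> ((U ^^ k) x))) \<longlonglongrightarrow> hnorm R (act R \<phi> x)"
proof -
  have unit: "(\<lambda>k. hnorm R (acts \<phi> ((U ^^ k) x))) \<longlonglongrightarrow> hnorm R (act R \<phi> x)"
    if x: "x \<in> carrier R" "hnorm R x \<le> 1" for x
  proof -
    let ?K = "\<lambda>y. acts \<phi> (act R \<phi> y) \<ominus> act R \<phi> (acts \<phi> y)"
    have "(\<lambda>k. ip R (?K ((U ^^ k) x)) ((U ^^ k) x)) \<longlonglongrightarrow> 0"
      by (rule compact_op_weakly_null)
        (use ess[OF \<phi>] x pure_weakly_null[OF pure x(1)] in \<open>auto simp: essentially_normal_op_def\<close>)
    then have "(\<lambda>k. sqrt ((hnorm R (act R \<phi> x))\<^sup>2 - Re (ip R (?K ((U ^^ k) x)) ((U ^^ k) x))))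
        \<longlonglongrightarrow> sqrt ((hnorm R (act R \<phi> x))\<^sup>2 - Re 0)"
      by (intro tendsto_intros)
    moreover have "sqrt ((hnorm R (act R \<phi> x))\<^sup>2 - Re (ip R (?K ((U ^^ k) x)) ((U ^^ k) x))) =
        hnorm R (acts \<phi> ((U ^^ k) x))" for k
    proof -
      \<comment> \<open>The action commutes with the isometry \<open>U ^^ k\<close>, so this norm
        does not depend on \<open>k\<close>.\<close>
      have "hnorm R (act R \<phi> x) = hnorm R (act R \<phi> ((U ^^ k) x))"
        using \<phi> x by (simp flip: U_pow_act)
      moreover have "Re (ip R (?K y) y) = (hnorm R (act R \<phi> y))\<^sup>2 - (hnorm R (acts \<phi> y))\<^sup>2"
        if "y \<in> carrier R" for y
        using \<phi> that by (simp add: hnorm_sq) (simp add: ip_acts)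
      ultimately show ?thesis using \<phi> x by simp
    qed
    ultimately show ?thesis using \<phi> x by simp
  qed
  \<comment> \<open>Adding 1 keeps the divisor positive when \<open>x\<close> is zero.\<close>
  define c where "c = hnorm R x + 1"
  have c: "0 < c" "hnorm R x \<le> c" unfolding c_def using hnorm_ge_0[OF x] by simp_all
  define u where "u = complex_of_real (1 / c) \<odot> x"
  have u: "u \<in> carrier R" "hnorm R u \<le> 1" unfolding u_def using x c by (simp_all add: norm_divide)
  have xu: "x = complex_of_real c \<odot> u"
    unfolding u_def by (rule vec_eqI) (use x c in auto)
  have "(\<lambda>k. c * hnorm R (acts \<phi> ((U ^^ k) u))) \<longlonglongrightarrow> c * hnorm R (act R \<phi> u)"
    by (intro tendsto_intros unit u)
  then show ?thesis
    using u \<phi> c unfolding xu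
    by (simp add: act_smult bounded_linear_opD(3)[OF acts_op]
        bounded_linear_opD(3)[OF bounded_linear_op_funpow[OF U_op]])
qed

lemma hnorm_ext_adj_emb:
  assumes \<phi>: "\<phi> \<in> A_carrier \<Omega>" and x: "x \<in> carrier R"
  shows "hnorm N (ext_adj \<phi> (code (emb j x))) = hnorm N (ext_act \<phi> (code (emb j x)))"
proof -
  have "(\<lambda>k. hnorm R (acts \<phi> (emb j x k))) \<longlonglongrightarrow> hnorm N (ext_adj \<phi> (code (emb j x)))"
    unfolding ext_adj_code[OF coherent_emb[OF x]]
    by (rule hnorm_limit_space_tendsto[OF coherent_acts[OF \<phi> coherent_emb[OF x]]])
  moreover have "(\<lambda>k. hnorm R (acts \<phi> (emb j x k))) \<longlonglongrightarrow> hnorm R (act R \<phi> x)"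
    \<comment> \<open>From coordinate \<open>j\<close> on, \<open>emb j x\<close> consists of the
      powers of \<open>U\<close> applied to \<open>x\<close>.\<close>
    by (rule LIMSEQ_offset[where k = j]) (simp add: emb_def hnorm_acts_U_pow \<phi> x)
  ultimately have "hnorm N (ext_adj \<phi> (code (emb j x))) = hnorm R (act R \<phi> x)"
    by (rule LIMSEQ_unique)
  then show ?thesis using \<phi> x by (simp add: ext_act_emb)
qed

text \<open>Both sides are continuous in \<open>f\<close>, and they agree on the dense set of
  vectors \<open>W^-k x\<close>.\<close>

lemma hnorm_ext_adj:
  assumes \<phi>: "\<phi> \<in> A_carrier \<Omega>" and f: "f \<in> carrier N"
  shows "hnorm N (ext_adj \<phi> f) = hnorm N (ext_act \<phi> f)"
proof -
  obtain a where a: "coherent a" "f = code a" using f by (rule limit_space_cases)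
  let ?s = "\<lambda>k. code (emb k (a k))"
  note ac = coherent_carrier[OF a(1)]
  have s: "?s k \<in> carrier N" for k by (rule code_carrier[OF coherent_emb[OF ac]])
  have t: "N.tends ?s f" unfolding a(2) by (rule emb_tendsto[OF a(1)])
  have "(\<lambda>k. hnorm N (ext_adj \<phi> (?s k))) \<longlonglongrightarrow> hnorm N (ext_adj \<phi> f)"
    using s f \<phi> by (intro N.tends_hnorm N.bounded_linear_op_tends[OF ext_adj_op[OF \<phi>] s f t]) auto
  moreover have "(\<lambda>k. hnorm N (ext_act \<phi> (?s k))) \<longlonglongrightarrow> hnorm N (ext_act \<phi> f)"
    using s f \<phi> by (intro N.tends_hnorm N.bounded_linear_op_tends[OF ext_act_op[OF \<phi>] s f t]) auto
  ultimately show ?thesis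
    unfolding hnorm_ext_adj_emb[OF \<phi> ac] by (rule LIMSEQ_unique)
qed

text \<open>Polarization upgrades the equality of norms to equality of the forms of the two products
  of \<open>ext_act \<phi>\<close> and its adjoint, hence of the products themselves.\<close>

lemma normal_ext_act:
  assumes \<phi>: "\<phi> \<in> A_carrier \<Omega>"
  shows "normal_op N (ext_act \<phi>)"
  unfolding normal_op_def
proof (intro ballI)
  fix f assume f: "f \<in> carrier N"
  have eq: "ip N (ext_act \<phi> g) (ext_act \<phi> f) = ip N (ext_adj \<phi> g) (ext_adj \<phi> f)"
    if g: "g \<in> carrier N" for g
  proof -
    have "ip N (ext_act \<phi> g) (ext_act \<phi> f) - ip N (ext_adj \<phi> g) (ext_adj \<phi> f) = 0"
    proof (rule N.polarization
        [where Q = "\<lambda>g f. ip N (ext_act \<phi> g) (ext_act \<phi> f) - ip N (ext_adj \<phi> g) (ext_adj \<phi> f)"])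
      show "ip N (ext_act \<phi> h) (ext_act \<phi> h) - ip N (ext_adj \<phi> h) (ext_adj \<phi> h) = 0"
        if "h \<in> carrier N" for h
        using \<phi> that N.ip_self[of "ext_act \<phi> h"] N.ip_self[of "ext_adj \<phi> h"]
        by (simp add: hnorm_ext_adj)
    qed (use f g \<phi> in \<open>simp_all add: N.bounded_linear_opD(2,3)[OF ext_act_op]
        N.bounded_linear_opD(2,3)[OF ext_adj_op] algebra_simps\<close>)
    then show ?thesis by simp
  qed
  have "ext_adj \<phi> (ext_act \<phi> f) = ext_act \<phi> (ext_adj \<phi> f)"
    by (rule N.vec_eqI_right) (use \<phi> f eq in \<open>auto simp flip: ip_ext_act(2) simp: ip_ext_act(1)\<close>)
  then show "adj N (ext_act \<phi>) (ext_act \<phi> f) = ext_act \<phi> (adj N (ext_act \<phi>) f)"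
    using \<phi> f by (simp add: adj_ext_act)
qed

theorem subnormal_R: "subnormal \<Omega> R"
  unfolding subnormal_def reductive_def
  using hilbert_module_over_N normal_ext_act embeds_N by (intro exI[of _ N]) simp

end

theorem theorem4:
  fixes \<Omega> :: "(complex ^ 'n::finite) set"
    and R :: "('a, 'n) hilbert_module"
    and U :: "'a \<Rightarrow> 'a"
  assumes "open \<Omega>" and "connected \<Omega>" and "\<Omega> \<noteq> {}" and "bounded \<Omega>"
    and "essentially_reductive \<Omega> R"
    and "isometric_module_map \<Omega> R R U"
    and "(\<Inter>k::nat. (U ^^ k) ` carrier R) = {\<zero>\<^bsub>R\<^esub>}"
  shows "subnormal \<Omega> R"
proof -
  interpret contractive_module \<Omega> R
    using assms by unfold_locales (auto simp: essentially_reductive_def)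
  obtain d :: "nat \<Rightarrow> 'a" where d: "\<And>j. d j \<in> carrier R"
    "\<And>x e. \<lbrakk>x \<in> carrier R; 0 < e\<rbrakk> \<Longrightarrow> \<exists>j. hnorm R (x \<ominus>\<^bsub>R\<^esub> d j) < e"
    using dense_sequence by blast
  have U: "U x \<in> carrier R" "hnorm R (U x) = hnorm R x"
      "y \<in> carrier R \<Longrightarrow> U (x \<oplus>\<^bsub>R\<^esub> y) = U x \<oplus>\<^bsub>R\<^esub> U y"
      "\<phi> \<in> A_carrier \<Omega> \<Longrightarrow> U (act R \<phi> x) = act R \<phi> (U x)" if "x \<in> carrier R" for x y \<phi>
    using assms(6) that unfolding isometric_module_map_def by auto
  have "U (c \<odot>\<^bsub>R\<^esub> x) = c \<odot>\<^bsub>R\<^esub> U x" if "x \<in> carrier R" for c x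
    using U(4)[OF that A_carrier_const, of c] U(1) that by (simp add: act_const)
  then interpret pure_essentially_reductive \<Omega> R U d
    using assms(5,7) d U by unfold_locales (auto simp: essentially_reductive_def)
  show ?thesis by (rule subnormal_R)
qed

end
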